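(* Let $K$ be an algebraically closed field of arbitrary characteristic, $V=K^n$, $G=GL_n(K)$, and $X=V^{\oplus m}\oplus(V^* )^{\oplus q}$ with $m,q>n$ and the diagonal $G$-action. The morphism $\psi:X\to M_{m,q}$, $(\underline u,\underline\xi)\mapsto(\langle u_i,\xi_j\rangle)_{1\le i\le m,1\le j\le q}$, maps $X$ into the determinantal variety $D_{n+1}(M_{m,q})$, and the induced homomorphism $\psi^*:K[D_{n+1}(M_{m,q})]\to K[X]$ between the coordinate rings induces an isomorphism $\psi^*:K[D_{n+1}(M_{m,q})]\to K[X]^G$; i.e. the determinantal variety $D_{n+1}(M_{m,q})$ is the categorical quotient of $X$ by $G$.
   Context: Points of $X$ are written $(\underline u,\underline\xi)=(u_1,\dots,u_m,\xi_1,\dots,\xi_q)$ with $u_i\in V$, $\xi_j\in V^*$, and $\langle u_i,\xi_j\rangle=\xi_j(u_i)$. $G=GL(V)$ acts by $g\cdot(\underline u,\underline\xi)=(gu_1,\dots,gu_m,\xi_1^g,\dots,\xi_q^g)$ where $\xi^g(v)=\xi(g^{-1}v)$. $M_{m,q}$ is the affine space of $m\times q$ matrices over $K$, and $D_{n+1}(M_{m,q})\subset M_{m,q}$ is the closed subvariety whose defining ideal is generated by all $(n+1)\times(n+1)$ minors of the generic $m\times q$ matrix. *)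

theory Defs
  imports
    "HOL-Algebra.QuotRing"
    "HOL-Computational_Algebra.Polynomial"
    "Jordan_Normal_Form.Determinant"
    "Jordan_Normal_Form.DL_Submatrix"
begin

text \<open>
  A variety is given by its set of points together with its coordinate functions. Since the ground
  field is infinite, the coordinate ring of an affine space is the ring of polynomial functions on
  it. Functions are taken extensional, so that equality of functions is equality on the variety.
\<close>

inductive_set regular_functions :: "'p set \<Rightarrow> ('p \<Rightarrow> 'k :: comm_ring_1) set \<Rightarrow> ('p \<Rightarrow> 'k) set"
  for S :: "'p set" and C :: "('p \<Rightarrow> 'k) set"
where
  const: "(\<lambda>x\<in>S. c) \<in> regular_functions S C"
| coord: "f \<in> C \<Longrightarrow> (\<lambda>x\<in>S. f x) \<in> regular_functions S C"
| add: "f \<in> regular_functions S C \<Longrightarrow> g \<in> regular_functions S C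
        \<Longrightarrow> (\<lambda>x\<in>S. f x + g x) \<in> regular_functions S C"
| mult: "f \<in> regular_functions S C \<Longrightarrow> g \<in> regular_functions S C
        \<Longrightarrow> (\<lambda>x\<in>S. f x * g x) \<in> regular_functions S C"

definition function_ring :: "'p set \<Rightarrow> ('p \<Rightarrow> 'k :: comm_ring_1) set \<Rightarrow> ('p \<Rightarrow> 'k) ring" where
  "function_ring S F =
    \<lparr> carrier = F,
      monoid.mult = (\<lambda>f g. \<lambda>x\<in>S. f x * g x),
      one = (\<lambda>x\<in>S. 1),
      zero = (\<lambda>x\<in>S. 0),
      add = (\<lambda>f g. \<lambda>x\<in>S. f x + g x) \<rparr>"

definition pullback :: "'p set \<Rightarrow> ('p \<Rightarrow> 'r) \<Rightarrow> ('r \<Rightarrow> 'k) \<Rightarrow> 'p \<Rightarrow> 'k" where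
  "pullback S \<phi> f = (\<lambda>x\<in>S. f (\<phi> x))"

definition regular_maps ::
    "'p set \<Rightarrow> ('p \<Rightarrow> 'k) set \<Rightarrow> 'r set \<Rightarrow> ('r \<Rightarrow> 'k) set \<Rightarrow> ('p \<Rightarrow> 'r) set" where
  "regular_maps S F T F' = {\<phi> \<in> S \<rightarrow>\<^sub>E T. \<forall>f\<in>F'. pullback S \<phi> f \<in> F}"

definition invariant_map :: "'g set \<Rightarrow> ('g \<Rightarrow> 'p \<Rightarrow> 'p) \<Rightarrow> 'p set \<Rightarrow> ('p \<Rightarrow> 'r) \<Rightarrow> bool" where
  "invariant_map \<Gamma> act S \<phi> \<longleftrightarrow> (\<forall>g\<in>\<Gamma>. \<forall>x\<in>S. \<phi> (act g x) = \<phi> x)"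

text \<open>Up to isomorphism, every affine variety is a closed subset of some affine space.\<close>

definition affine_coordinates :: "nat \<Rightarrow> ('k vec \<Rightarrow> 'k) set" where
  "affine_coordinates N = {\<lambda>z. z $ k | k. k < N}"

definition affine_closed :: "nat \<Rightarrow> 'k :: comm_ring_1 vec set \<Rightarrow> bool" where
  "affine_closed N Z \<longleftrightarrow>
    (\<exists>P \<subseteq> regular_functions (carrier_vec N) (affine_coordinates N).
      Z = {z \<in> carrier_vec N. \<forall>p\<in>P. p z = 0})"

text \<open>
  The universal property of the quotient, in the category of affine varieties. The source is
  \<open>(S, F)\<close> with an action of \<open>\<Gamma>\<close>, and the target is \<open>(T, F')\<close>.
\<close>

definition affine_categorical_quotient ::
    "'g set \<Rightarrow> ('g \<Rightarrow> 'p \<Rightarrow> 'p) \<Rightarrow> 'p set \<Rightarrow> ('p \<Rightarrow> 'k :: comm_ring_1) set \<Rightarrow>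
     'r set \<Rightarrow> ('r \<Rightarrow> 'k) set \<Rightarrow> ('p \<Rightarrow> 'r) \<Rightarrow> bool" where
  "affine_categorical_quotient \<Gamma> act S F T F' \<pi> \<longleftrightarrow>
    \<pi> \<in> regular_maps S F T F' \<and>
    invariant_map \<Gamma> act S \<pi> \<and>
    (\<forall>N Z \<phi>. affine_closed N Z \<longrightarrow>
       \<phi> \<in> regular_maps S F Z (regular_functions Z (affine_coordinates N)) \<longrightarrow>
       invariant_map \<Gamma> act S \<phi> \<longrightarrow>
       (\<exists>!\<phi>'. \<phi>' \<in> regular_maps T F' Z (regular_functions Z (affine_coordinates N)) \<and>
              (\<forall>x\<in>S. \<phi> x = \<phi>' (\<pi> x))))"

text \<open>
  \<open>V = K\<^sup>n\<close> is \<open>carrier_vec n\<close>, and \<open>V\<^sup>*\<close> consists of linear functionals on it.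
  All families are indexed from 0.
\<close>

definition dual_space :: "nat \<Rightarrow> ('k :: comm_ring_1 vec \<Rightarrow> 'k) set" where
  "dual_space n = {\<xi> \<in> carrier_vec n \<rightarrow>\<^sub>E UNIV.
     (\<forall>v\<in>carrier_vec n. \<forall>w\<in>carrier_vec n. \<xi> (v + w) = \<xi> v + \<xi> w) \<and>
     (\<forall>c. \<forall>v\<in>carrier_vec n. \<xi> (c \<cdot>\<^sub>v v) = c * \<xi> v)}"

type_synonym 'k point = "(nat \<Rightarrow> 'k vec) \<times> (nat \<Rightarrow> 'k vec \<Rightarrow> 'k)"

definition X_points :: "nat \<Rightarrow> nat \<Rightarrow> nat \<Rightarrow> 'k :: comm_ring_1 point set" where
  "X_points n m q = ({..<m} \<rightarrow>\<^sub>E carrier_vec n) \<times> ({..<q} \<rightarrow>\<^sub>E dual_space n)"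

text \<open>The coordinates of a functional are taken with respect to the dual of the standard basis.\<close>

definition X_coordinates :: "nat \<Rightarrow> nat \<Rightarrow> nat \<Rightarrow> ('k :: comm_ring_1 point \<Rightarrow> 'k) set" where
  "X_coordinates n m q =
    {\<lambda>(u, \<xi>). u i $ k | i k. i < m \<and> k < n} \<union> {\<lambda>(u, \<xi>). \<xi> j (unit_vec n k) | j k. j < q \<and> k < n}"

definition regular_X :: "nat \<Rightarrow> nat \<Rightarrow> nat \<Rightarrow> ('k :: comm_ring_1 point \<Rightarrow> 'k) set" where
  "regular_X n m q = regular_functions (X_points n m q) (X_coordinates n m q)"

definition X_ring :: "nat \<Rightarrow> nat \<Rightarrow> nat \<Rightarrow> ('k :: comm_ring_1 point \<Rightarrow> 'k) ring" where
  "X_ring n m q = function_ring (X_points n m q) (regular_X n m q)"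

definition GL :: "'k :: comm_ring_1 itself \<Rightarrow> nat \<Rightarrow> 'k mat monoid" where
  "GL ty n = units_of (ring_mat ty n ())"

definition GL_act ::
    "nat \<Rightarrow> nat \<Rightarrow> nat \<Rightarrow> 'k :: comm_ring_1 mat \<Rightarrow> 'k point \<Rightarrow> 'k point" where
  "GL_act n m q g = (\<lambda>(u, \<xi>).
     (\<lambda>i\<in>{..<m}. g *\<^sub>v u i,
      \<lambda>j\<in>{..<q}. \<lambda>v\<in>carrier_vec n. \<xi> j (inv\<^bsub>GL TYPE('k) n\<^esub> g *\<^sub>v v)))"

definition invariant_ring :: "nat \<Rightarrow> nat \<Rightarrow> nat \<Rightarrow> ('k :: comm_ring_1 point \<Rightarrow> 'k) ring" where
  "invariant_ring n m q = function_ring (X_points n m q)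
     {f \<in> regular_X n m q.
        invariant_map (carrier (GL TYPE('k) n)) (GL_act n m q) (X_points n m q) f}"

definition matrix_coordinates :: "nat \<Rightarrow> nat \<Rightarrow> ('k mat \<Rightarrow> 'k) set" where
  "matrix_coordinates m q = {\<lambda>A. A $$ (i, j) | i j. i < m \<and> j < q}"

definition matrix_ring :: "nat \<Rightarrow> nat \<Rightarrow> ('k :: comm_ring_1 mat \<Rightarrow> 'k) ring" where
  "matrix_ring m q = function_ring (carrier_mat m q)
     (regular_functions (carrier_mat m q) (matrix_coordinates m q))"

definition minors :: "nat \<Rightarrow> nat \<Rightarrow> nat \<Rightarrow> ('k :: comm_ring_1 mat \<Rightarrow> 'k) set" where
  "minors r m q = {\<lambda>A\<in>carrier_mat m q. det (submatrix A I J) | I J.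
     I \<subseteq> {..<m} \<and> J \<subseteq> {..<q} \<and> card I = r \<and> card J = r}"

definition determinantal_ideal :: "nat \<Rightarrow> nat \<Rightarrow> nat \<Rightarrow> ('k :: comm_ring_1 mat \<Rightarrow> 'k) set" where
  "determinantal_ideal r m q = Idl\<^bsub>matrix_ring m q\<^esub> (minors r m q)"

definition determinantal_variety :: "nat \<Rightarrow> nat \<Rightarrow> nat \<Rightarrow> 'k :: comm_ring_1 mat set" where
  "determinantal_variety r m q =
     {A \<in> carrier_mat m q. \<forall>f\<in>determinantal_ideal r m q. f A = 0}"

text \<open>
  The coordinate ring is the quotient by the ideal generated by the minors, not by the ideal of all
  functions vanishing on the set of points (that the two agree is a nontrivial fact).
\<close>

definition determinantal_ring :: "nat \<Rightarrow> nat \<Rightarrow> nat \<Rightarrow> ('k :: comm_ring_1 mat \<Rightarrow> 'k) set ring" where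
  "determinantal_ring r m q = matrix_ring m q Quot determinantal_ideal r m q"

definition \<psi> :: "nat \<Rightarrow> nat \<Rightarrow> nat \<Rightarrow> 'k :: comm_ring_1 point \<Rightarrow> 'k mat" where
  "\<psi> n m q = (\<lambda>(u, \<xi>)\<in>X_points n m q. mat m q (\<lambda>(i, j). \<xi> j (u i)))"

text \<open>
  The map on cosets induced by pulling back along \<open>\<psi>\<close>; \<open>the_elem\<close> is meaningful only where the
  pullback is constant on the coset, i.e. once the ideal is known to pull back to zero.
\<close>

definition \<psi>_star ::
    "nat \<Rightarrow> nat \<Rightarrow> nat \<Rightarrow> ('k :: comm_ring_1 mat \<Rightarrow> 'k) set \<Rightarrow> 'k point \<Rightarrow> 'k" where
  "\<psi>_star n m q C = the_elem (pullback (X_points n m q) (\<psi> n m q) ` C)"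

end

theory Submission
  imports Defs
begin

text \<open>
  The coordinate ring of the space of \<open>m \<times> q\<close> matrices is spanned by monomials
  \<open>z\<^sup>b = \<Prod> z\<^sub>i\<^sub>j ^ b\<^sub>i\<^sub>j\<close>. Give \<open>z\<^sup>b\<close> the weight \<open>\<Sum> (i + 1) (j + 1) b\<^sub>i\<^sub>j\<close>, and call a
  sequence of positions in which both indices increase strictly a chain. By the rearrangement
  inequality the diagonal term of a minor is its unique term of largest weight, so modulo the minors
  of size \<open>n + 1\<close> a monomial whose support contains a chain of \<open>n + 1\<close> positions is a combination
  of monomials of smaller weight. Hence the monomials without such chains span the quotient by
  these minors (lemma \<open>reduction\<close>).

  These monomials stay linearly independent after the substitution
  \<open>z\<^sub>i\<^sub>j = \<Sum>\<^sub>k u\<^sub>i\<^sub>k \<xi>\<^sub>k\<^sub>j\<close>, over every infinite field. Split the support of \<open>a\<close> into \<open>n\<close> parts \<open>a\<^sub>k\<close>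
  containing no two positions below one another, for instance by the length of the longest chain
  ending at a position, and look at the monomial of the substituted polynomial in which the \<open>u\<^sub>i\<^sub>k\<close>
  carry the row sums and the \<open>\<xi>\<^sub>k\<^sub>j\<close> the column sums of \<open>a\<^sub>k\<close>. If \<open>z\<^sup>b\<close> contributes to it, then
  \<open>b = \<Sum> b\<^sub>k\<close> where \<open>b\<^sub>k\<close> has the margins of \<open>a\<^sub>k\<close>. An exponent without chains of two positions is
  the unique one of smallest weight with its margins (lemma \<open>chain_free_weight_minimal\<close>), so \<open>b\<close>
  has larger weight than \<open>a\<close> unless \<open>b\<^sub>k = a\<^sub>k\<close> for all \<open>k\<close>. If \<open>a\<close> has maximal weight among the
  monomials of a polynomial, then its coefficient is therefore also a coefficient of the substituted
  polynomial, with multiplicity one (lemma \<open>leading_coefficient_vanishes\<close>). As the multinomial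
  coefficients involved are 1, the characteristic does not matter. This proves that the minors
  generate the kernel of the pullback along \<open>\<psi>\<close> (\<open>second_fundamental_theorem\<close>).

  For the invariants, let \<open>d\<close> be the minor on the first \<open>n\<close> rows and the last \<open>n\<close> columns. Where
  \<open>d\<close> does not vanish, the last \<open>n\<close> functionals are the rows of an invertible matrix, and acting by
  that matrix moves a point to one whose coordinates are rational functions of the entries of its
  image under \<open>\<psi>\<close>, with powers of \<open>d\<close> as denominators. So an invariant multiplied by a power of
  \<open>d\<close> is a polynomial in the entries of \<open>\<psi>\<close>, and it remains to divide by \<open>d\<close>, one factor at a time
  (lemma \<open>corner_division\<close>). Modulo \<open>d\<close> and the minors of size \<open>n + 1\<close> one can also avoid the
  monomials that contain the diagonal of \<open>d\<close>. The pullback of \<open>d\<close> is the product of the determinant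
  of the first \<open>n\<close> vectors and that of the last \<open>n\<close> functionals, so a multiple of it vanishes as
  soon as the last coordinates of these vectors, or of these functionals, are all zero. For every
  remaining monomial the parts \<open>a\<^sub>k\<close> can be chosen so that the coefficient extracted above survives
  one of these two specialisations: otherwise there would be chains of \<open>n\<close> positions inside the first
  \<open>n\<close> rows and inside the last \<open>n\<close> columns, and if a diagonal position of \<open>d\<close> were missing, an initial
  part of the former and a final part of the latter would join to a chain of \<open>n + 1\<close> positions
  (lemma \<open>level_decomposition\<close>).

  Finally, \<open>\<psi>\<close> maps onto the determinantal variety, so a morphism that is constant on orbits has at
  most one factorisation through \<open>\<psi>\<close>, and writing its components as polynomials in the entries of
  \<open>\<psi>\<close> gives one.
\<close>

section \<open>Weights of exponents\<close>

text \<open>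
  The diagonal term of a minor outweighs its other terms. If \<open>\<pi>\<close> moves the last index \<open>r\<close>, composing it
  with a transposition that makes it fix \<open>r\<close> strictly increases the sum, which reduces to a permutation
  of fewer indices; the induction therefore carries the weak inequality along with the strict one.
\<close>

lemma rearrangement_strict:
  fixes x y :: "nat \<Rightarrow> nat"
  assumes "\<And>s t. s < t \<Longrightarrow> t < r \<Longrightarrow> x s < x t" and "\<And>s t. s < t \<Longrightarrow> t < r \<Longrightarrow> y s < y t"
    and "\<pi> permutes {0..<r}" and "\<pi> \<noteq> id"
  shows "(\<Sum>t = 0..<r. x t * y (\<pi> t)) < (\<Sum>t = 0..<r. x t * y t)"
proof -
  have "(\<Sum>t = 0..<r. x t * y (\<pi> t)) \<le> (\<Sum>t = 0..<r. x t * y t) \<and>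
     (\<pi> \<noteq> id \<longrightarrow> (\<Sum>t = 0..<r. x t * y (\<pi> t)) < (\<Sum>t = 0..<r. x t * y t))"
    using assms(1-3)
  proof (induction r arbitrary: \<pi>)
    case 0
    then show ?case by simp
  next
    case (Suc r)
    have reduce: "\<sigma> permutes {0..<r}" if "\<sigma> permutes {0..<Suc r}" "\<sigma> r = r" for \<sigma>
      by (rule permutes_superset[OF that(1)]) (use that(2) in \<open>auto simp: less_Suc_eq\<close>)
    have IH: "(\<Sum>t = 0..<r. x t * y (\<sigma> t)) \<le> (\<Sum>t = 0..<r. x t * y t) \<and>
     (\<sigma> \<noteq> id \<longrightarrow> (\<Sum>t = 0..<r. x t * y (\<sigma> t)) < (\<Sum>t = 0..<r. x t * y t))"
      if "\<sigma> permutes {0..<r}" for \<sigma>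
      by (rule Suc.IH[OF _ _ that]) (use Suc.prems(1,2) in auto)
    show ?case
    proof (cases "\<pi> r = r")
      case True
      then show ?thesis using IH[OF reduce[OF Suc.prems(3) True]] by (simp add: id_def)
    next
      case False
      define s where "s = inv_into UNIV \<pi> r"
      have ps: "\<pi> s = r" unfolding s_def using Suc.prems(3) by (simp add: permutes_inverses)
      have sr: "s < r"
        using False ps Suc.prems(3) permutes_in_image[OF Suc.prems(3), of s]
        by (cases "s = r") auto
      have pr: "\<pi> r < r"
        using False permutes_in_image[OF Suc.prems(3), of r] by auto
      define \<sigma> where "\<sigma> = \<pi> \<circ> Transposition.transpose s r"
      have "\<sigma> permutes {0..<Suc r}" unfolding \<sigma>_def
        by (intro permutes_compose[OF _ Suc.prems(3)] permutes_swap_id) (use sr in auto)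
      moreover have "\<sigma> r = r" by (simp add: \<sigma>_def ps)
      ultimately have le: "(\<Sum>t = 0..<r. x t * y (\<sigma> t)) \<le> (\<Sum>t = 0..<r. x t * y t)"
        using IH[OF reduce] by blast
      have split: "(\<Sum>t = 0..<r. f t) = f s + (\<Sum>t \<in> {0..<r} - {s}. f t)" for f :: "nat \<Rightarrow> nat"
        using sr by (intro sum.remove) auto
      have same: "(\<Sum>t \<in> {0..<r} - {s}. x t * y (\<sigma> t)) = (\<Sum>t \<in> {0..<r} - {s}. x t * y (\<pi> t))"
        by (intro sum.cong) (auto simp: \<sigma>_def Transposition.transpose_def)
      have "x s < x r" "y (\<pi> r) < y r" using Suc.prems(1)[OF sr] Suc.prems(2)[OF pr] by auto
      then have "x s * y r + x r * y (\<pi> r) < x s * y (\<pi> r) + x r * y r"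
      proof -
        assume a: "x s < x r" "y (\<pi> r) < y r"
        obtain c d where "x r = x s + Suc c" "y r = y (\<pi> r) + Suc d"
          using less_imp_Suc_add[OF a(1)] less_imp_Suc_add[OF a(2)] by auto
        then show ?thesis by (simp add: algebra_simps)
      qed
      moreover have "\<sigma> s = \<pi> r" by (simp add: \<sigma>_def)
      ultimately show ?thesis
        using le split[of "\<lambda>t. x t * y (\<sigma> t)"] split[of "\<lambda>t. x t * y (\<pi> t)"] same ps by simp
    qed
  qed
  then show ?thesis using assms(4) by blast
qed

text \<open>
  The factors are shifted by one so that the weight is a sum of quadrant sums, one quadrant for each
  position, including those in row 0 and column 0.
\<close>

definition weight :: "nat \<Rightarrow> nat \<Rightarrow> (nat \<times> nat \<Rightarrow> nat) \<Rightarrow> nat" where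
  "weight m q b = (\<Sum>p\<in>{..<m} \<times> {..<q}. (fst p + 1) * (snd p + 1) * b p)"

definition quadrant :: "nat \<Rightarrow> nat \<Rightarrow> (nat \<times> nat \<Rightarrow> nat) \<Rightarrow> nat \<Rightarrow> nat \<Rightarrow> nat" where
  "quadrant m q b s t = (\<Sum>i = s..<m. \<Sum>j = t..<q. b (i, j))"

lemma weight_eq_sum_quadrants: "weight m q b = (\<Sum>s<m. \<Sum>t<q. quadrant m q b s t)"
proof -
  have 1: "(\<Sum>s<N. \<Sum>i = s..<N. f i) = (\<Sum>i<N. (i + 1) * f i)" for N and f :: "nat \<Rightarrow> nat"
  proof -
    have "(\<Sum>s<N. \<Sum>i = s..<N. f i) = (\<Sum>s<N. \<Sum>i<N. if s \<le> i then f i else 0)"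
      by (intro sum.cong refl sum.mono_neutral_cong_left) auto
    also have "\<dots> = (\<Sum>i<N. \<Sum>s<N. if s \<le> i then f i else 0)" by (rule sum.swap)
    also have "\<dots> = (\<Sum>i<N. (i + 1) * f i)"
    proof (rule sum.cong[OF refl])
      fix i assume "i \<in> {..<N}"
      then have "(\<Sum>s<N. if s \<le> i then f i else 0) = (\<Sum>s\<le>i. f i)"
        by (intro sum.mono_neutral_cong_right) auto
      then show "(\<Sum>s<N. if s \<le> i then f i else 0) = (i + 1) * f i" by simp
    qed
    finally show ?thesis .
  qed
  have "(\<Sum>s<m. \<Sum>t<q. quadrant m q b s t) = (\<Sum>s<m. \<Sum>i = s..<m. \<Sum>t<q. \<Sum>j = t..<q. b (i, j))"
    unfolding quadrant_def by (intro sum.cong refl sum.swap)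
  also have "\<dots> = (\<Sum>i<m. \<Sum>j<q. (i + 1) * (j + 1) * b (i, j))"
    unfolding 1 by (simp add: sum_distrib_left algebra_simps)
  finally show ?thesis by (simp add: weight_def sum.cartesian_product case_prod_beta)
qed

lemma quadrant_recover:
  assumes "i < m" "j < q"
  shows "b (i, j) + quadrant m q b (Suc i) j + quadrant m q b i (Suc j)
    = quadrant m q b i j + quadrant m q b (Suc i) (Suc j)"
  using assms by (simp add: quadrant_def sum.atLeast_Suc_lessThan sum.distrib)

text \<open>
  Apart from the margins and the total, a quadrant sum depends only on the sum over the opposite
  quadrant. This is what compares two exponents with equal margins.
\<close>

lemma quadrant_margins:
  assumes "s \<le> m" "t \<le> q"
  shows "(\<Sum>i = s..<m. \<Sum>j<q. b (i, j)) + (\<Sum>j = t..<q. \<Sum>i<m. b (i, j)) + (\<Sum>i<s. \<Sum>j<t. b (i, j))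
    = (\<Sum>i<m. \<Sum>j<q. b (i, j)) + quadrant m q b s t"
proof -
  have split: "(\<Sum>i<N. f i) = (\<Sum>i<k. f i) + (\<Sum>i = k..<N. f i)" if "k \<le> N"
    for k N and f :: "nat \<Rightarrow> nat"
    using that by (simp add: lessThan_atLeast0 sum.atLeastLessThan_concat)
  have "(\<Sum>j = t..<q. \<Sum>i<m. b (i, j)) = (\<Sum>i<m. \<Sum>j = t..<q. b (i, j))" by (rule sum.swap)
  then show ?thesis
    by (simp add: split[OF assms(1)] split[OF assms(2)] sum.distrib quadrant_def)
qed

text \<open>
  By \<open>quadrant_margins\<close>, an exponent with given margins has a quadrant sum at least as large as a
  quantity determined by the margins, with equality if the opposite quadrant is empty. If the support
  of \<open>a\<close> contains no position strictly below another in both directions, then for each quadrant either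
  \<open>a\<close> vanishes on it or \<open>a\<close> vanishes on the opposite one, so \<open>a\<close> minimises all quadrant sums at
  once. Quadrant sums determine the exponent, whence uniqueness.
\<close>

lemma chain_free_weight_minimal:
  assumes rows: "\<And>i. i < m \<Longrightarrow> (\<Sum>j<q. a (i, j)) = (\<Sum>j<q. b (i, j))"
    and cols: "\<And>j. j < q \<Longrightarrow> (\<Sum>i<m. a (i, j)) = (\<Sum>i<m. b (i, j))"
    and free: "\<And>i i' j j'. i < i' \<Longrightarrow> i' < m \<Longrightarrow> j < j' \<Longrightarrow> j' < q \<Longrightarrow> a (i, j) = 0 \<or> a (i', j') = 0"
  shows "weight m q a \<le> weight m q b"
    and "weight m q a = weight m q b \<Longrightarrow> i < m \<Longrightarrow> j < q \<Longrightarrow> a (i, j) = b (i, j)"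
proof -
  have le: "quadrant m q a s t \<le> quadrant m q b s t" if "s \<le> m" "t \<le> q" for s t
  proof (cases "quadrant m q a s t = 0")
    case False
    then obtain i' j' where ij: "s \<le> i'" "i' < m" "t \<le> j'" "j' < q" "a (i', j') \<noteq> 0"
      unfolding quadrant_def
      by (metis (no_types, lifting) atLeastLessThan_iff sum.neutral)
    have "(\<Sum>i<s. \<Sum>j<t. a (i, j)) = 0" using free ij
      by (intro sum.neutral ballI) (metis lessThan_iff order_less_le_trans)
    moreover have "(\<Sum>i = s..<m. \<Sum>j<q. a (i, j)) = (\<Sum>i = s..<m. \<Sum>j<q. b (i, j))"
      "(\<Sum>j = t..<q. \<Sum>i<m. a (i, j)) = (\<Sum>j = t..<q. \<Sum>i<m. b (i, j))"
      "(\<Sum>i<m. \<Sum>j<q. a (i, j)) = (\<Sum>i<m. \<Sum>j<q. b (i, j))"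
      by (auto intro!: sum.cong rows cols)
    ultimately show ?thesis using quadrant_margins[OF that, of a] quadrant_margins[OF that, of b] by linarith
  qed simp
  show "weight m q a \<le> weight m q b"
    unfolding weight_eq_sum_quadrants by (intro sum_mono le) auto
  assume eq: "weight m q a = weight m q b" and ij: "i < m" "j < q"
  have qeq: "quadrant m q a s t = quadrant m q b s t" if "s \<le> m" "t \<le> q" for s t
  proof (cases "s < m \<and> t < q")
    case True
    have "(\<Sum>(s, t)\<in>{..<m} \<times> {..<q}. quadrant m q a s t) = (\<Sum>(s, t)\<in>{..<m} \<times> {..<q}. quadrant m q b s t)"
      using eq by (simp add: weight_eq_sum_quadrants sum.cartesian_product)
    from sum_mono_inv[OF this _ _ finite_cartesian_product, of "(s, t)"] show ?thesis
      using True le by auto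
  next
    case False
    then show ?thesis using that by (auto simp: quadrant_def)
  qed
  show "a (i, j) = b (i, j)"
    using quadrant_recover[OF ij, of a] quadrant_recover[OF ij, of b] qeq ij by simp
qed

section \<open>Chains and levels\<close>

text \<open>
  Chains of \<open>r + 1\<close> elements of \<open>S\<close> ending in \<open>p\<close>. The relation is a parameter because both the strict
  order on positions and its converse are needed.
\<close>

inductive chain_at :: "('a \<Rightarrow> 'a \<Rightarrow> bool) \<Rightarrow> 'a set \<Rightarrow> nat \<Rightarrow> 'a \<Rightarrow> bool" for R S where
  start: "p \<in> S \<Longrightarrow> chain_at R S 0 p"
| step: "chain_at R S r p' \<Longrightarrow> R p' p \<Longrightarrow> p \<in> S \<Longrightarrow> chain_at R S (Suc r) p"

lemma chain_at_mem: "chain_at R S r p \<Longrightarrow> p \<in> S"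
  by (erule chain_at.cases) auto

lemma chain_at_shorter: "chain_at R S r p \<Longrightarrow> k \<le> r \<Longrightarrow> \<exists>p'. chain_at R S k p'"
  by (induction rule: chain_at.induct) (auto simp: le_Suc_eq intro: chain_at.intros)

definition level :: "('a \<Rightarrow> 'a \<Rightarrow> bool) \<Rightarrow> 'a set \<Rightarrow> 'a \<Rightarrow> nat" where
  "level R S p = (GREATEST r. chain_at R S r p)"

lemma
  assumes "\<nexists>p. chain_at R S n p" "p \<in> S"
  shows chain_at_level: "chain_at R S (level R S p) p"
    and level_less: "level R S p < n"
    and level_strict: "p' \<in> S \<Longrightarrow> R p p' \<Longrightarrow> level R S p < level R S p'"
proof -
  have b: "r \<le> n" if "chain_at R S r p" for r p
    using chain_at_shorter[OF that, of n] assms(1) by force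
  show l: "chain_at R S (level R S p) p" unfolding level_def
    by (rule GreatestI_nat[where k = 0 and b = n]) (use assms(2) b in \<open>auto intro: chain_at.start\<close>)
  show "level R S p < n" using assms(1) b[OF l] l le_neq_implies_less by blast
  assume "p' \<in> S" "R p p'"
  then have "chain_at R S (Suc (level R S p)) p'" using chain_at.step[OF l] by blast
  then have "Suc (level R S p) \<le> level R S p'" unfolding level_def[of R S p']
    by (rule Greatest_le_nat[where b = n]) (use b in auto)
  then show "level R S p < level R S p'" by simp
qed

definition below :: "nat \<times> nat \<Rightarrow> nat \<times> nat \<Rightarrow> bool" where
  "below p p' \<longleftrightarrow> fst p < fst p' \<and> snd p < snd p'"

lemma chain_at_sequence:
  assumes "chain_at below S r p"
  shows "\<exists>c. (\<forall>t\<le>r. c t \<in> S) \<and> (\<forall>t\<le>r. \<forall>s<t. below (c s) (c t)) \<and> c r = p"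
  using assms
proof (induction rule: chain_at.induct)
  case (start p)
  then show ?case by (intro exI[of _ "\<lambda>_. p"]) auto
next
  case (step r p' p)
  then obtain c where c: "\<forall>t\<le>r. c t \<in> S" "\<forall>t\<le>r. \<forall>s<t. below (c s) (c t)" "c r = p'" by auto
  have "below (c s) p" if "s \<le> r" for s
  proof (cases "s = r")
    case False
    then have "below (c s) p'" using c that by auto
    then show ?thesis using step.hyps(2) by (auto simp: below_def)
  qed (use c step.hyps(2) in simp)
  then show ?case using c step.hyps(3)
    by (intro exI[of _ "c(Suc r := p)"]) (auto simp: le_Suc_eq less_Suc_eq_le)
qed

text \<open>
  A chain of the converse relation is a chain read backwards from its last element, so it can be
  attached behind a chain of the relation itself.
\<close>

lemma chain_at_append:
  assumes "chain_at (\<lambda>p p'. below p' p) S r p'" "chain_at below S k p" "below p p'"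
  shows "\<exists>p''. chain_at below S (k + r + 1) p''"
  using assms
proof (induction arbitrary: k p rule: chain_at.induct)
  case (start p')
  then have "chain_at below S (Suc k) p'" by (blast intro: chain_at.step)
  then show ?case by (metis Suc_eq_plus1 add_0_right)
next
  case (step r p1 p')
  have "chain_at below S (Suc k) p'" using step by (auto intro: chain_at.step)
  from step.IH[OF this step.hyps(2)] show ?case by simp
qed

lemma chain_at_row_bound: "chain_at below S r p \<Longrightarrow> r \<le> fst p"
  by (induction rule: chain_at.induct) (auto simp: below_def)

lemma chain_at_col_bound:
  "chain_at (\<lambda>p p'. below p' p) S r p \<Longrightarrow> \<forall>p\<in>S. snd p < q \<Longrightarrow> snd p + r < q"
  by (induction rule: chain_at.induct) (auto simp: below_def)

text \<open>
  A chain of \<open>r + 1\<close> positions inside the first \<open>r + 1\<close> rows uses every one of them. The bound on the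
  column of its element in row \<open>k\<close> comes from the \<open>r - k\<close> elements that follow.
\<close>

lemma chain_in_top_rows:
  assumes "chain_at below S r p" "fst p \<le> r" "k \<le> r"
  shows "\<exists>j. chain_at below S k (k, j) \<and> j + (r - k) \<le> snd p"
  using assms
proof (induction rule: chain_at.induct)
  case (start p)
  then have "chain_at below S 0 (0, snd p)" "k = 0"
    by (cases p, auto intro: chain_at.start)+
  then show ?case by auto
next
  case (step r p' p)
  have full: "chain_at below S (Suc r) p" using step.hyps by (rule chain_at.step)
  show ?case
  proof (cases "k = Suc r")
    case True
    have "fst p = Suc r" using chain_at_row_bound[OF full] step.prems by simp
    then show ?thesis using full True by (metis add_0_right diff_self_eq_0 order_refl prod.collapse)
  next
    case False
    then show ?thesis using step by (fastforce simp: below_def)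
  qed
qed

lemma chain_in_last_cols:
  assumes "chain_at (\<lambda>p p'. below p' p) S r p" "\<forall>p\<in>S. snd p < q" "q \<le> snd p + r + 1" "k \<le> r"
  shows "\<exists>i. chain_at (\<lambda>p p'. below p' p) S k (i, q - 1 - k) \<and> fst p + (r - k) \<le> i"
  using assms
proof (induction rule: chain_at.induct)
  case (start p)
  have "snd p = q - 1" using start by force
  then have "chain_at (\<lambda>p p'. below p' p) S 0 (fst p, q - 1)" "k = 0"
    using start by (cases p, auto intro: chain_at.start)+
  then show ?case by auto
next
  case (step r p' p)
  have full: "chain_at (\<lambda>p p'. below p' p) S (Suc r) p" using step.hyps by (rule chain_at.step)
  show ?case
  proof (cases "k = Suc r")
    case True
    have "snd p = q - 1 - Suc r" using chain_at_col_bound[OF full step.prems(1)] step.prems by simp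
    then show ?thesis using full True by (metis add_0_right diff_self_eq_0 order_refl prod.collapse)
  next
    case False
    then show ?thesis using step by (fastforce simp: below_def)
  qed
qed

text \<open>
  Colour a position by the length of the longest chain ending at it. The last colour \<open>n - 1\<close> is then
  absent from the first \<open>n\<close> rows unless these contain a chain of \<open>n\<close> positions. Colouring by the longest
  chain starting at a position instead, the last colour is absent from the last \<open>n\<close> columns unless
  these contain such a chain. If both colourings fail and the diagonal position in row \<open>k\<close> is missing,
  then the element of the first chain in row \<open>k\<close> lies to the left of it and the element of the second
  chain in its column lies beneath it, so the first \<open>k + 1\<close> elements of the one and the last \<open>n - k\<close> elements of the other
  form a chain of \<open>n + 1\<close> positions.
\<close>

lemma level_decomposition:
  assumes S: "S \<subseteq> {..<m} \<times> {..<q}" and n: "n < q"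
    and short: "\<nexists>p. chain_at below S n p" and corner: "\<not> (\<forall>k<n. (k, q - n + k) \<in> S)"
  shows "\<exists>l. (\<forall>p\<in>S. l p < n) \<and> (\<forall>p\<in>S. \<forall>p'\<in>S. below p p' \<longrightarrow> l p \<noteq> l p') \<and>
     ((\<forall>p\<in>S. fst p < n \<longrightarrow> l p \<noteq> n - 1) \<or> (\<forall>p\<in>S. q - n \<le> snd p \<longrightarrow> l p \<noteq> n - 1))"
proof -
  let ?U = "\<lambda>p p'. below p' p"
  have cols: "\<forall>p\<in>S. snd p < q" using S by auto
  have short': "\<nexists>p. chain_at ?U S n p"
  proof
    assume "\<exists>p. chain_at ?U S n p"
    then obtain p where p: "chain_at ?U S n p" by blast
    show False
    proof (cases n)
      case 0
      then show ?thesis using short chain_at.start[OF chain_at_mem[OF p]] by blast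
    next
      case (Suc n')
      obtain p1 where p1: "chain_at ?U S n' p1" "below p p1"
        using p Suc by (auto elim: chain_at.cases)
      then show ?thesis
        using chain_at_append[OF p1(1) chain_at.start p1(2)] chain_at_mem[OF p] short Suc by auto
    qed
  qed
  obtain k where k: "k < n" "(k, q - n + k) \<notin> S" using corner by blast
  show ?thesis
  proof (cases "\<exists>p. chain_at below S (n - 1) p \<and> fst p < n")
    case False
    then show ?thesis
      using chain_at_level[OF short] level_less[OF short] level_strict[OF short]
      by (intro exI[of _ "level below S"]) (metis less_irrefl)
  next
    case True
    then obtain p where p: "chain_at below S (n - 1) p" "fst p < n" by blast
    obtain j where j: "chain_at below S k (k, j)" "j + (n - 1 - k) \<le> snd p"
      using chain_in_top_rows[OF p(1), of k] p(2) k(1)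
      by (metis One_nat_def Suc_pred gr_implies_not0 less_Suc_eq_le not_gr_zero)
    have "\<not> (\<exists>p. chain_at ?U S (n - 1) p \<and> q - n \<le> snd p)"
    proof
      assume "\<exists>p. chain_at ?U S (n - 1) p \<and> q - n \<le> snd p"
      then obtain p' where p': "chain_at ?U S (n - 1) p'" "q - n \<le> snd p'" by blast
      obtain i where i: "chain_at ?U S (n - 1 - k) (i, q - 1 - (n - 1 - k))" "fst p' + k \<le> i"
      proof -
        have "q \<le> snd p' + (n - 1) + 1" "n - 1 - k \<le> n - 1" "n - 1 - (n - 1 - k) = k"
          using p'(2) k(1) n by auto
        then show ?thesis
          using chain_in_last_cols[OF p'(1) cols, of "n - 1 - k"] that by metis
      qed
      have e: "q - 1 - (n - 1 - k) = q - n + k" using k(1) n by auto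
      have "(k, j) \<in> S" "(i, q - n + k) \<in> S"
        using chain_at_mem[OF j(1)] chain_at_mem[OF i(1)] e by auto
      moreover have "snd p < q" using chain_at_mem[OF p(1)] cols by auto
      ultimately have "below (k, j) (i, q - n + k)"
        using k i(2) j(2) n by (auto simp: below_def nat_less_le)
      then have "\<exists>p. chain_at below S (k + (n - 1 - k) + 1) p"
        using chain_at_append[OF i(1) j(1)] e by simp
      then show False using short k(1) by simp
    qed
    then show ?thesis
      using chain_at_level[OF short'] level_less[OF short'] level_strict[OF short']
      by (intro exI[of _ "level ?U S"]) (metis less_irrefl)
  qed
qed

section \<open>Leading coefficients of substituted polynomials\<close>

text \<open>
  Over an infinite field a polynomial function determines its coefficients. The exponents \<open>\<epsilon> s\<close> need
  not be distinct, so a coefficient is the sum of the \<open>\<gamma> s\<close> with the given exponent. A polynomial that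
  is only known to vanish where the variables in \<open>Y\<close> are zero still has vanishing coefficients at
  the monomials free of these variables.
\<close>

lemma coefficient_extraction:
  fixes \<gamma> :: "'s \<Rightarrow> 'k :: field" and \<epsilon> :: "'s \<Rightarrow> 'v \<Rightarrow> nat"
  assumes inf: "infinite (UNIV :: 'k set)" and "finite V" "finite S"
    and "\<And>x. \<forall>v\<in>Y. x v = 0 \<Longrightarrow> (\<Sum>s\<in>S. \<gamma> s * (\<Prod>v\<in>V. x v ^ \<epsilon> s v)) = 0"
    and "\<forall>v\<in>Y \<inter> V. e v = 0"
  shows "(\<Sum>s\<in>{s\<in>S. \<forall>v\<in>V. \<epsilon> s v = e v}. \<gamma> s) = 0"
  using assms(2-)
proof (induction V arbitrary: S rule: finite_induct)
  case empty
  then show ?case using empty.prems(2)[of "\<lambda>_. 0"] by simp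
next
  case (insert v V)
  let ?S = "{s\<in>S. \<epsilon> s v = e v}"
  have "(\<Sum>s\<in>?S. \<gamma> s * (\<Prod>w\<in>V. x w ^ \<epsilon> s w)) = 0" if x: "\<forall>v\<in>Y. x v = 0" for x
  proof -
    let ?c = "\<lambda>s. \<gamma> s * (\<Prod>w\<in>V. x w ^ \<epsilon> s w)"
    have eval: "(\<Sum>s\<in>S. ?c s * t ^ \<epsilon> s v) = 0" if "v \<in> Y \<Longrightarrow> t = 0" for t
    proof -
      have "(\<Prod>w\<in>V. (x(v := t)) w ^ \<epsilon> s w) = (\<Prod>w\<in>V. x w ^ \<epsilon> s w)" for s
        using insert.hyps(2) by (intro prod.cong) auto
      then show ?thesis
        using insert.prems(2)[of "x(v := t)"] insert.hyps x that by (simp add: mult_ac)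
    qed
    show ?thesis
    proof (cases "v \<in> Y")
      case True
      then have "e v = 0" using insert.prems(3) by simp
      moreover have "(\<Sum>s\<in>S. ?c s * 0 ^ \<epsilon> s v) = (\<Sum>s\<in>{s\<in>S. \<epsilon> s v = 0}. ?c s)"
        using insert.prems(1) by (intro sum.mono_neutral_cong_right) auto
      ultimately show ?thesis using eval[of 0] by simp
    next
      case False
      let ?p = "\<Sum>s\<in>S. monom (?c s) (\<epsilon> s v)"
      have "poly ?p t = 0" for t using eval[of t] False by (simp add: poly_sum poly_monom)
      then have "?p = 0" using poly_roots_finite[of ?p] inf by (auto simp: Collect_const)
      then have "coeff ?p (e v) = 0" by simp
      moreover have "coeff ?p (e v) = (\<Sum>s\<in>?S. ?c s)"
        unfolding coeff_sum using insert.prems(1) by (intro sum.mono_neutral_cong_right) auto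
      ultimately show ?thesis by simp
    qed
  qed
  then have "(\<Sum>s\<in>{s\<in>?S. \<forall>w\<in>V. \<epsilon> s w = e w}. \<gamma> s) = 0"
    using insert.prems by (intro insert.IH) auto
  then show ?case by (simp add: conj_commute conj_left_commute cong: conj_cong)
qed

lemma prod_count:
  assumes "finite I" "finite V" "h ` I \<subseteq> V"
  shows "(\<Prod>s\<in>I. x (h s)) = (\<Prod>v\<in>V. x v ^ card {s\<in>I. h s = v} :: 'k :: comm_monoid_mult)"
  unfolding prod.group[OF assms, of "\<lambda>s. x (h s)", symmetric] by (intro prod.cong) auto

text \<open>
  Expanding the powers of \<open>\<Sum>\<^sub>k u\<^sub>i\<^sub>k \<xi>\<^sub>k\<^sub>j\<close> amounts to choosing an index \<open>k\<close> for each factor of the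
  monomial, that is, to splitting \<open>b\<close> into parts indexed by \<open>k\<close>, and the resulting monomial records
  the row and column sums of the parts. Fix the monomial of the splitting of \<open>a\<close> by \<open>l\<close>. Since each
  part of this splitting is of minimal weight for its margins and \<open>a\<close> is of maximal weight in \<open>B\<close>, no
  other splitting, of \<open>a\<close> or of another \<open>b\<close>, gives the same monomial. Its coefficient is thus \<open>c a\<close>. The
  assumptions on \<open>Y\<close> say that the monomial is free of the variables in \<open>Y\<close>.
\<close>

lemma leading_coefficient_vanishes:
  fixes c :: "(nat \<times> nat \<Rightarrow> nat) \<Rightarrow> 'k :: field" and n :: nat and Y :: "(nat \<times> nat + nat \<times> nat) set"
  assumes inf: "infinite (UNIV :: 'k set)" and B: "finite B" "\<And>b p. b \<in> B \<Longrightarrow> p \<notin> {..<m} \<times> {..<q} \<Longrightarrow> b p = 0"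
    and a: "a \<in> B" "\<And>b. b \<in> B \<Longrightarrow> weight m q b \<le> weight m q a"
    and l: "\<And>p. p \<in> {..<m} \<times> {..<q} \<Longrightarrow> a p \<noteq> 0 \<Longrightarrow> l p < n"
    and free: "\<And>p p'. a p \<noteq> 0 \<Longrightarrow> a p' \<noteq> 0 \<Longrightarrow> below p p' \<Longrightarrow> l p \<noteq> l p'"
    and YL: "\<And>i k. Inl (i, k) \<in> Y \<Longrightarrow> (\<forall>j<q. a (i, j) \<noteq> 0 \<longrightarrow> l (i, j) \<noteq> k)"
    and YR: "\<And>j k. Inr (j, k) \<in> Y \<Longrightarrow> (\<forall>i<m. a (i, j) \<noteq> 0 \<longrightarrow> l (i, j) \<noteq> k)"
    and van: "\<And>x. \<forall>v\<in>Y. x v = 0 \<Longrightarrow>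
      (\<Sum>b\<in>B. c b * (\<Prod>p\<in>{..<m} \<times> {..<q}. (\<Sum>k<n. x (Inl (fst p, k)) * x (Inr (snd p, k))) ^ b p)) = 0"
  shows "c a = 0"
proof -
  let ?G = "{..<m} \<times> {..<q}"
  define V :: "(nat \<times> nat + nat \<times> nat) set"
    where "V = Inl ` ({..<m} \<times> {..<n}) \<union> Inr ` ({..<q} \<times> {..<n})"
  define I where "I b = Sigma ?G (\<lambda>p. {..<b p})" for b :: "nat \<times> nat \<Rightarrow> nat"
  define E where "E b = PiE (I b) (\<lambda>_. {..<n})" for b :: "nat \<times> nat \<Rightarrow> nat"
  (* A factor of the monomial is a pair s of a position and a counter; under the choice g it
     contributes the variables hl g s and hr g s. *)
  define hl :: "((nat \<times> nat) \<times> nat \<Rightarrow> nat) \<Rightarrow> (nat \<times> nat) \<times> nat \<Rightarrow> (nat \<times> nat + nat \<times> nat)"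
    where "hl g s = Inl (fst (fst s), g s)" for g s
  define hr :: "((nat \<times> nat) \<times> nat \<Rightarrow> nat) \<Rightarrow> (nat \<times> nat) \<times> nat \<Rightarrow> (nat \<times> nat + nat \<times> nat)"
    where "hr g s = Inr (snd (fst s), g s)" for g s
  define \<epsilon> where "\<epsilon> b g v = card {s\<in>I b. hl g s = v} + card {s\<in>I b. hr g s = v}" for b g v
  have fI: "finite (I b)" for b unfolding I_def by auto
  have fV: "finite V" unfolding V_def by auto
  have expand: "(\<Prod>p\<in>?G. (\<Sum>k<n. x (Inl (fst p, k)) * x (Inr (snd p, k))) ^ b p)
      = (\<Sum>g\<in>E b. \<Prod>v\<in>V. x v ^ \<epsilon> b g v)" for x :: "nat \<times> nat + nat \<times> nat \<Rightarrow> 'k" and b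
  proof -
    have "(\<Prod>p\<in>?G. (\<Sum>k<n. x (Inl (fst p, k)) * x (Inr (snd p, k))) ^ b p)
      = (\<Prod>p\<in>?G. \<Prod>t<b p. \<Sum>k<n. x (Inl (fst p, k)) * x (Inr (snd p, k)))" by simp
    also have "\<dots> = (\<Prod>s\<in>I b. \<Sum>k<n. x (Inl (fst (fst s), k)) * x (Inr (snd (fst s), k)))"
      unfolding I_def by (subst prod.Sigma) (auto simp: case_prod_beta)
    also have "\<dots> = (\<Sum>g\<in>E b. \<Prod>s\<in>I b. x (Inl (fst (fst s), g s)) * x (Inr (snd (fst s), g s)))"
      unfolding E_def using fI by (subst prod_sum_PiE) auto
    also have "\<dots> = (\<Sum>g\<in>E b. \<Prod>v\<in>V. x v ^ \<epsilon> b g v)"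
    proof (rule sum.cong[OF refl])
      fix g assume g: "g \<in> E b"
      have gs: "g s < n" "fst (fst s) < m" "snd (fst s) < q" if "s \<in> I b" for s
        using that g unfolding E_def I_def by (auto dest!: PiE_mem)
      have "(\<Prod>s\<in>I b. x (hl g s)) = (\<Prod>v\<in>V. x v ^ card {s\<in>I b. hl g s = v})"
        by (rule prod_count[OF fI fV]) (use gs in \<open>auto simp: V_def hl_def\<close>)
      moreover have "(\<Prod>s\<in>I b. x (hr g s)) = (\<Prod>v\<in>V. x v ^ card {s\<in>I b. hr g s = v})"
        by (rule prod_count[OF fI fV]) (use gs in \<open>auto simp: V_def hr_def\<close>)
      ultimately show "(\<Prod>s\<in>I b. x (Inl (fst (fst s), g s)) * x (Inr (snd (fst s), g s))) = (\<Prod>v\<in>V. x v ^ \<epsilon> b g v)"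
        by (simp add: \<epsilon>_def power_add prod.distrib hl_def hr_def)
    qed
    finally show ?thesis .
  qed
  (* The k-th part of the splitting of b given by g. *)
  define part where "part b g k p = card {t. t < b p \<and> g (p, t) = k}"
    for b :: "nat \<times> nat \<Rightarrow> nat" and g :: "(nat \<times> nat) \<times> nat \<Rightarrow> nat" and k :: nat and p
  have row: "(\<Sum>j<q. part b g k (i, j)) = \<epsilon> b g (Inl (i, k))" if "i < m" for b g i k
  proof -
    have "{s\<in>I b. hl g s = Inl (i, k)} = Sigma ({i} \<times> {..<q}) (\<lambda>p. {t. t < b p \<and> g (p, t) = k})"
      using that by (auto simp: I_def hl_def)
    then have "card {s\<in>I b. hl g s = Inl (i, k)} = (\<Sum>p\<in>{i} \<times> {..<q}. part b g k p)"
      unfolding part_def by (simp add: card_SigmaI)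
    moreover have "card {s\<in>I b. hr g s = Inl (i, k)} = 0" by (simp add: hr_def)
    ultimately show ?thesis unfolding \<epsilon>_def
      using sum.cartesian_product[of "\<lambda>i j. part b g k (i, j)" "{..<q}" "{i}"] by simp
  qed
  have col: "(\<Sum>i<m. part b g k (i, j)) = \<epsilon> b g (Inr (j, k))" if "j < q" for b g j k
  proof -
    have "{s\<in>I b. hr g s = Inr (j, k)} = Sigma ({..<m} \<times> {j}) (\<lambda>p. {t. t < b p \<and> g (p, t) = k})"
      using that by (auto simp: I_def hr_def)
    then have "card {s\<in>I b. hr g s = Inr (j, k)} = (\<Sum>p\<in>{..<m} \<times> {j}. part b g k p)"
      unfolding part_def by (simp add: card_SigmaI)
    moreover have "card {s\<in>I b. hl g s = Inr (j, k)} = 0" by (simp add: hl_def)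
    ultimately show ?thesis unfolding \<epsilon>_def
      using sum.cartesian_product[of "\<lambda>i j. part b g k (i, j)" "{j}" "{..<m}"] by simp
  qed
  have total: "b p = (\<Sum>k<n. part b g k p)" if "g \<in> E b" "p \<in> ?G" for b g p
  proof -
    have "(\<Sum>k<n. \<Sum>t\<in>{t\<in>{..<b p}. g (p, t) = k}. 1) = (\<Sum>t<b p. 1 :: nat)"
      by (rule sum.group) (use that in \<open>auto simp: E_def I_def dest!: PiE_mem\<close>)
    then show ?thesis by (simp add: part_def)
  qed
  have weight_total: "weight m q b = (\<Sum>k<n. weight m q (part b g k))" if "g \<in> E b" for b g
  proof -
    have "weight m q b = (\<Sum>p\<in>?G. \<Sum>k<n. (fst p + 1) * (snd p + 1) * part b g k p)"
      unfolding weight_def by (intro sum.cong refl) (simp only: total[OF that] sum_distrib_left)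
    also have "\<dots> = (\<Sum>k<n. weight m q (part b g k))" unfolding weight_def by (rule sum.swap)
    finally show ?thesis .
  qed
  define g0 where "g0 = restrict (l \<circ> fst) (I a)"
  have g0: "g0 \<in> E a" using l by (auto simp: E_def g0_def I_def)
  have part0: "part a g0 k p = (if l p = k then a p else 0)" if "p \<in> ?G" for k p
  proof -
    have "{t. t < a p \<and> g0 (p, t) = k} = (if l p = k then {..<a p} else {})"
      using that by (auto simp: g0_def I_def)
    then show ?thesis by (simp add: part_def)
  qed
  have unique: "b = a \<and> g = g0" if bg: "b \<in> B" "g \<in> E b" and e: "\<forall>v\<in>V. \<epsilon> b g v = \<epsilon> a g0 v" for b g
  proof -
    have rows: "(\<Sum>j<q. part a g0 k (i, j)) = (\<Sum>j<q. part b g k (i, j))" if "k < n" "i < m" for k i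
      unfolding row[OF that(2)] using e that by (auto simp: V_def)
    have cols: "(\<Sum>i<m. part a g0 k (i, j)) = (\<Sum>i<m. part b g k (i, j))" if "k < n" "j < q" for k j
      unfolding col[OF that(2)] using e that by (auto simp: V_def)
    have free0: "part a g0 k (i, j) = 0 \<or> part a g0 k (i', j') = 0"
      if "i < i'" "i' < m" "j < j'" "j' < q" for k i i' j j'
    proof (cases "a (i, j) = 0 \<or> a (i', j') = 0")
      case False
      then show ?thesis using free[of "(i, j)" "(i', j')"] that by (auto simp: part0 below_def)
    qed (use that in \<open>auto simp: part0\<close>)
    have le: "weight m q (part a g0 k) \<le> weight m q (part b g k)" if "k < n" for k
      by (rule chain_free_weight_minimal(1)[OF rows cols free0]) (use that in auto)
    (* The weight of b is at most that of a, but each of its parts weighs at least as much as the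
       corresponding part of a; so all these inequalities are equalities. *)
    have "(\<Sum>k<n. weight m q (part a g0 k)) = (\<Sum>k<n. weight m q (part b g k))"
      using weight_total[OF g0] weight_total[OF bg(2)] a(2)[OF bg(1)] sum_mono[of "{..<n}", OF le]
      by (simp add: order_antisym)
    then have eq: "weight m q (part a g0 k) = weight m q (part b g k)" if "k < n" for k
      using sum_mono_inv[of _ "{..<n}" _ k] le that by auto
    have parts: "part a g0 k p = part b g k p" if "k < n" "p \<in> ?G" for k p
      using chain_free_weight_minimal(2)[OF rows[OF that(1)] cols[OF that(1)] free0 eq[OF that(1)]] that(2)
      by (cases p) auto
    have "b p = a p" for p
    proof (cases "p \<in> ?G")
      case True
      then show ?thesis unfolding total[OF bg(2) True] total[OF g0 True] using parts by auto
    next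
      case False
      then show ?thesis using B(2)[OF bg(1)] B(2)[OF a(1)] by simp
    qed
    then have ba: "b = a" by blast
    have "g s = g0 s" if sI: "s \<in> I a" for s
    proof -
      obtain p t where s: "s = (p, t)" "p \<in> ?G" "t < a p" using sI by (auto simp: I_def)
      have gs: "g s < n" using bg(2) that ba by (auto simp: E_def dest!: PiE_mem)
      have "t \<in> {t. t < b p \<and> g (p, t) = g s}" using s ba by simp
      then have "part b g (g s) p \<noteq> 0" unfolding part_def by (subst card_0_eq) auto
      then have "l p = g s" using parts[OF gs s(2)] part0[OF s(2)] by (auto split: if_splits)
      then show ?thesis using that s by (simp add: g0_def)
    qed
    then have "g = g0" using bg(2) g0 ba unfolding E_def by (auto intro: PiE_ext)
    with ba show ?thesis by blast
  qed
  have e0: "\<forall>v\<in>Y \<inter> V. \<epsilon> a g0 v = 0"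
  proof
    fix v assume v: "v \<in> Y \<inter> V"
    then consider i k where "v = Inl (i, k)" "i < m" | j k where "v = Inr (j, k)" "j < q"
      by (auto simp: V_def)
    then show "\<epsilon> a g0 v = 0"
    proof cases
      case (1 i k)
      then show ?thesis using YL[of i k] v by (auto simp: part0 simp flip: row)
    next
      case (2 j k)
      then show ?thesis using YR[of j k] v by (auto simp: part0 simp flip: col)
    qed
  qed
  have "(\<Sum>s\<in>{s\<in>Sigma B E. \<forall>v\<in>V. \<epsilon> (fst s) (snd s) v = \<epsilon> a g0 v}. c (fst s)) = 0"
  proof (rule coefficient_extraction[OF inf fV _ _ e0])
    show "finite (Sigma B E)" using B(1) fI by (intro finite_SigmaI) (auto simp: E_def intro!: finite_PiE)
    fix x :: "nat \<times> nat + nat \<times> nat \<Rightarrow> 'k" assume "\<forall>v\<in>Y. x v = 0"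
    from van[OF this] show "(\<Sum>s\<in>Sigma B E. c (fst s) * (\<Prod>v\<in>V. x v ^ \<epsilon> (fst s) (snd s) v)) = 0"
      unfolding expand sum_distrib_left using B(1) fI
      by (subst (asm) sum.Sigma) (auto simp: E_def case_prod_beta intro!: finite_PiE)
  qed
  moreover have "{s\<in>Sigma B E. \<forall>v\<in>V. \<epsilon> (fst s) (snd s) v = \<epsilon> a g0 v} = {(a, g0)}"
    using unique a(1) g0 by auto
  ultimately show ?thesis by simp
qed

section \<open>Reduction of polynomial functions modulo minors\<close>

lemma regular_restrict: "f \<in> regular_functions S C \<Longrightarrow> restrict f S = f"
  by (induction rule: regular_functions.induct) auto

lemma restrict_regular: "f \<in> regular_functions S C \<Longrightarrow> restrict f S \<in> regular_functions S C"
  by (simp add: regular_restrict)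

lemma regular_add:
  assumes "restrict f S \<in> regular_functions S C" "restrict g S \<in> regular_functions S C"
  shows "(\<lambda>x\<in>S. f x + g x) \<in> regular_functions S C"
proof -
  have "(\<lambda>x\<in>S. f x + g x) = (\<lambda>x\<in>S. restrict f S x + restrict g S x)" by auto
  then show ?thesis using regular_functions.add[OF assms] by simp
qed

lemma regular_mult:
  assumes "restrict f S \<in> regular_functions S C" "restrict g S \<in> regular_functions S C"
  shows "(\<lambda>x\<in>S. f x * g x) \<in> regular_functions S C"
proof -
  have "(\<lambda>x\<in>S. f x * g x) = (\<lambda>x\<in>S. restrict f S x * restrict g S x)" by auto
  then show ?thesis using regular_functions.mult[OF assms] by simp
qed

lemma regular_sum:
  assumes "\<And>i. i \<in> I \<Longrightarrow> restrict (f i) S \<in> regular_functions S C"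
  shows "(\<lambda>x\<in>S. \<Sum>i\<in>I. f i x) \<in> regular_functions S C"
  using assms
proof (induction I rule: infinite_finite_induct)
  case (insert i I)
  have "(\<lambda>x\<in>S. f i x + (\<Sum>i\<in>I. f i x)) \<in> regular_functions S C"
    by (intro regular_add insert.IH insert.prems) auto
  moreover have "(\<lambda>x\<in>S. \<Sum>i\<in>insert i I. f i x) = (\<lambda>x\<in>S. f i x + (\<Sum>i\<in>I. f i x))"
    by (intro restrict_ext) (simp add: insert.hyps)
  ultimately show ?case by (simp only:)
qed (auto intro: regular_functions.const)

lemma regular_prod:
  assumes "\<And>i. i \<in> I \<Longrightarrow> restrict (f i) S \<in> regular_functions S C"
  shows "(\<lambda>x\<in>S. \<Prod>i\<in>I. f i x) \<in> regular_functions S C"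
  using assms
proof (induction I rule: infinite_finite_induct)
  case (insert i I)
  have "(\<lambda>x\<in>S. f i x * (\<Prod>i\<in>I. f i x)) \<in> regular_functions S C"
    by (intro regular_mult insert.IH insert.prems) auto
  moreover have "(\<lambda>x\<in>S. \<Prod>i\<in>insert i I. f i x) = (\<lambda>x\<in>S. f i x * (\<Prod>i\<in>I. f i x))"
    by (intro restrict_ext) (simp add: insert.hyps)
  ultimately show ?case by (simp only:)
qed (auto intro: regular_functions.const)

lemma regular_power:
  assumes "restrict f S \<in> regular_functions S C"
  shows "(\<lambda>x\<in>S. f x ^ N) \<in> regular_functions S C"
  using regular_prod[of "{..<N}" "\<lambda>_. f"] assms by simp

lemma regular_det:
  assumes "\<And>i j. i < r \<Longrightarrow> j < r \<Longrightarrow> restrict (F i j) S \<in> regular_functions S C"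
  shows "(\<lambda>x\<in>S. det (mat r r (\<lambda>(i, j). F i j x))) \<in> regular_functions S C"
proof -
  have "(\<lambda>x\<in>S. \<Sum>p\<in>{p. p permutes {0..<r}}. signof p * (\<Prod>i = 0..<r. F i (p i) x)) \<in> regular_functions S C"
    using assms by (intro regular_sum regular_mult regular_prod regular_functions.const)
      (auto dest: permutes_in_image)
  moreover have "(\<Sum>p\<in>{p. p permutes {0..<r}}. signof p * (\<Prod>i = 0..<r. F i (p i) x))
      = det (mat r r (\<lambda>(i, j). F i j x))" for x
    by (subst det_def'[of _ r]) (auto intro!: sum.cong prod.cong arg_cong2[where f = "(*)"] dest: permutes_in_image)
  ultimately show ?thesis by simp
qed

abbreviation (input) regular_M :: "nat \<Rightarrow> nat \<Rightarrow> ('k :: comm_ring_1 mat \<Rightarrow> 'k) set" where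
  "regular_M m q \<equiv> regular_functions (carrier_mat m q) (matrix_coordinates m q)"

lemma regular_entry: "i < m \<Longrightarrow> j < q \<Longrightarrow> (\<lambda>A\<in>carrier_mat m q. A $$ (i, j)) \<in> regular_M m q"
  by (rule regular_functions.coord) (auto simp: matrix_coordinates_def)

definition monomial :: "nat \<Rightarrow> nat \<Rightarrow> (nat \<times> nat \<Rightarrow> nat) \<Rightarrow> 'k :: comm_ring_1 mat \<Rightarrow> 'k" where
  "monomial m q b A = (\<Prod>p\<in>{..<m} \<times> {..<q}. A $$ p ^ b p)"

lemma regular_monomial: "(\<lambda>A\<in>carrier_mat m q. monomial m q b A) \<in> regular_M m q"
  unfolding monomial_def by (intro regular_prod regular_power) (auto intro: regular_entry)

lemma monomial_add: "monomial m q (\<lambda>p. a p + b p) A = monomial m q a A * monomial m q b A"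
  by (simp add: monomial_def power_add prod.distrib)

lemma monomial_of_bool:
  assumes "P \<subseteq> {..<m} \<times> {..<q}"
  shows "monomial m q (\<lambda>p. of_bool (p \<in> P)) A = (\<Prod>p\<in>P. A $$ p)"
  unfolding monomial_def using assms by (intro prod.mono_neutral_cong_right) auto

lemma weight_add: "weight m q (\<lambda>p. a p + b p) = weight m q a + weight m q b"
  by (simp add: weight_def sum.distrib algebra_simps)

lemma weight_of_bool:
  assumes "P \<subseteq> {..<m} \<times> {..<q}"
  shows "weight m q (\<lambda>p. of_bool (p \<in> P)) = (\<Sum>p\<in>P. (fst p + 1) * (snd p + 1))"
  unfolding weight_def using assms by (intro sum.mono_neutral_cong_right) auto

definition exponents :: "nat \<Rightarrow> nat \<Rightarrow> (nat \<times> nat \<Rightarrow> nat) set" where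
  "exponents m q = {b. \<forall>p. p \<notin> {..<m} \<times> {..<q} \<longrightarrow> b p = 0}"

text \<open>
  Congruence modulo \<open>J\<close> to a combination of monomials with exponents in \<open>N\<close>. Only the values on the
  matrices of the right size count, which spares restricting every function to them.
\<close>

definition reducible_to ::
    "nat \<Rightarrow> nat \<Rightarrow> (nat \<times> nat \<Rightarrow> nat) set \<Rightarrow> ('k :: comm_ring_1 mat \<Rightarrow> 'k) set \<Rightarrow> ('k mat \<Rightarrow> 'k) \<Rightarrow> bool" where
  "reducible_to m q N J f \<longleftrightarrow> (\<exists>B c h. finite B \<and> B \<subseteq> N \<and> h \<in> J \<and>
     (\<forall>A\<in>carrier_mat m q. f A = (\<Sum>b\<in>B. c b * monomial m q b A) + h A))"

text \<open>
  Closure properties of an ideal, stated without reference to a ring structure, so that they can be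
  checked directly for a sum of an ideal and a principal ideal.
\<close>

definition absorbing :: "nat \<Rightarrow> nat \<Rightarrow> ('k :: comm_ring_1 mat \<Rightarrow> 'k) set \<Rightarrow> bool" where
  "absorbing m q J \<longleftrightarrow> (\<lambda>A\<in>carrier_mat m q. 0) \<in> J \<and>
     (\<forall>h\<in>J. \<forall>h'\<in>J. (\<lambda>A\<in>carrier_mat m q. h A + h' A) \<in> J) \<and>
     (\<forall>f\<in>regular_M m q. \<forall>h\<in>J. (\<lambda>A\<in>carrier_mat m q. f A * h A) \<in> J)"

lemma reducible_cong:
  "reducible_to m q N J f \<Longrightarrow> (\<And>A. A \<in> carrier_mat m q \<Longrightarrow> f A = g A) \<Longrightarrow> reducible_to m q N J g"
  unfolding reducible_to_def by (metis (full_types))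

lemma reducible_monomial: "absorbing m q J \<Longrightarrow> b \<in> N \<Longrightarrow> reducible_to m q N J (monomial m q b)"
  unfolding reducible_to_def absorbing_def
  by (intro exI[of _ "{b}"] exI[of _ "\<lambda>_. 1"] exI[of _ "\<lambda>A\<in>carrier_mat m q. 0"]) auto

lemma reducible_absorbed: "h \<in> J \<Longrightarrow> reducible_to m q N J h"
  unfolding reducible_to_def by (intro exI[of _ "{}"] exI[of _ "\<lambda>_. 0"] exI[of _ h]) auto

lemma reducible_scale:
  assumes J: "absorbing m q J" and f: "reducible_to m q N J f"
  shows "reducible_to m q N J (\<lambda>A. k * f A)"
proof -
  obtain B c h where 1: "finite B" "B \<subseteq> N" "h \<in> J"
      "\<forall>A\<in>carrier_mat m q. f A = (\<Sum>b\<in>B. c b * monomial m q b A) + h A"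
    using f unfolding reducible_to_def by blast
  have "(\<lambda>A\<in>carrier_mat m q. (\<lambda>A\<in>carrier_mat m q. k) A * h A) \<in> J"
    using J 1(3) regular_functions.const unfolding absorbing_def by blast
  then show ?thesis unfolding reducible_to_def using 1
    by (intro exI[of _ B] exI[of _ "\<lambda>b. k * c b"] exI) (auto simp: algebra_simps sum_distrib_left)
qed

lemma reducible_add:
  assumes J: "absorbing m q J" and f: "reducible_to m q N J f" and g: "reducible_to m q N J g"
  shows "reducible_to m q N J (\<lambda>A. f A + g A)"
proof -
  obtain B c h where 1: "finite B" "B \<subseteq> N" "h \<in> J"
      "\<forall>A\<in>carrier_mat m q. f A = (\<Sum>b\<in>B. c b * monomial m q b A) + h A"
    using f unfolding reducible_to_def by blast
  obtain B' c' h' where 2: "finite B'" "B' \<subseteq> N" "h' \<in> J"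
      "\<forall>A\<in>carrier_mat m q. g A = (\<Sum>b\<in>B'. c' b * monomial m q b A) + h' A"
    using g unfolding reducible_to_def by blast
  let ?c = "\<lambda>b. of_bool (b \<in> B) * c b + of_bool (b \<in> B') * c' b"
  have hh: "(\<lambda>A\<in>carrier_mat m q. h A + h' A) \<in> J"
    using J 1(3) 2(3) unfolding absorbing_def by blast
  have "(\<Sum>b\<in>B \<union> B'. ?c b * monomial m q b A) = (\<Sum>b\<in>B. c b * monomial m q b A) + (\<Sum>b\<in>B'. c' b * monomial m q b A)"
    for A :: "'a mat"
  proof -
    have "(\<Sum>b\<in>B \<union> B'. of_bool (b \<in> B) * c b * monomial m q b A) = (\<Sum>b\<in>B. c b * monomial m q b A)"
      using 1(1) 2(1) by (intro sum.mono_neutral_cong_right) auto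
    moreover have "(\<Sum>b\<in>B \<union> B'. of_bool (b \<in> B') * c' b * monomial m q b A) = (\<Sum>b\<in>B'. c' b * monomial m q b A)"
      using 1(1) 2(1) by (intro sum.mono_neutral_cong_right) auto
    ultimately show ?thesis by (simp add: distrib_right sum.distrib)
  qed
  then show ?thesis unfolding reducible_to_def using 1 2 hh
    by (intro exI[of _ "B \<union> B'"] exI[of _ ?c] exI[of _ "\<lambda>A\<in>carrier_mat m q. h A + h' A"]) auto
qed

lemma reducible_sum:
  assumes J: "absorbing m q J" and f: "\<And>i. i \<in> I \<Longrightarrow> reducible_to m q N J (f i)"
  shows "reducible_to m q N J (\<lambda>A. \<Sum>i\<in>I. f i A)"
  using f
proof (induction I rule: infinite_finite_induct)
  case (insert i I)
  then show ?case using reducible_add[OF J, of N "f i" "\<lambda>A. \<Sum>i\<in>I. f i A"] by simp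
next
  case empty
  then show ?case using J
    by (auto intro!: reducible_cong[OF reducible_absorbed[of "\<lambda>A\<in>carrier_mat m q. 0"]] simp: absorbing_def)
next
  case (infinite I)
  then show ?case using J
    by (auto intro!: reducible_cong[OF reducible_absorbed[of "\<lambda>A\<in>carrier_mat m q. 0"]] simp: absorbing_def)
qed

lemma absorbing_zero: "absorbing m q {\<lambda>A\<in>carrier_mat m q. 0}"
  by (auto simp: absorbing_def)

lemma polynomial_expansion:
  assumes "f \<in> regular_M m q"
  obtains B c where "finite B" "B \<subseteq> exponents m q"
    "\<And>A. A \<in> carrier_mat m q \<Longrightarrow> f A = (\<Sum>b\<in>B. c b * monomial m q b A)"
proof -
  let ?J = "{\<lambda>A\<in>carrier_mat m q. 0}"
  have plain: thesis if f: "reducible_to m q (exponents m q) ?J f"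
    and t: "\<And>B c. finite B \<Longrightarrow> B \<subseteq> exponents m q \<Longrightarrow>
      \<forall>A\<in>carrier_mat m q. f A = (\<Sum>b\<in>B. c b * monomial m q b A) \<Longrightarrow> thesis" for f and thesis
  proof -
    from f obtain B c h where B: "finite B" "B \<subseteq> exponents m q" "h \<in> ?J"
      "\<forall>A\<in>carrier_mat m q. f A = (\<Sum>b\<in>B. c b * monomial m q b A) + h A"
      unfolding reducible_to_def by blast
    show thesis by (rule t[OF B(1,2), of c]) (use B(3,4) in simp)
  qed
  have "reducible_to m q (exponents m q) ?J f" using assms
  proof (induction rule: regular_functions.induct)
    case (const k)
    have "reducible_to m q (exponents m q) ?J (\<lambda>A. k * monomial m q (\<lambda>_. 0) A)"
      by (intro reducible_scale reducible_monomial absorbing_zero) (auto simp: exponents_def)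
    then show ?case by (rule reducible_cong) (simp add: monomial_def)
  next
    case (coord f)
    then obtain i j where f: "f = (\<lambda>A. A $$ (i, j))" "i < m" "j < q"
      by (auto simp: matrix_coordinates_def)
    have "reducible_to m q (exponents m q) ?J (monomial m q (\<lambda>p. of_bool (p \<in> {(i, j)})))"
      using f by (intro reducible_monomial absorbing_zero) (auto simp: exponents_def)
    then show ?case
    proof (rule reducible_cong)
      fix A :: "'a mat" assume "A \<in> carrier_mat m q"
      then show "monomial m q (\<lambda>p. of_bool (p \<in> {(i, j)})) A = restrict f (carrier_mat m q) A"
        by (subst monomial_of_bool) (use f in auto)
    qed
  next
    case (add f g)
    from reducible_add[OF absorbing_zero add.IH] show ?case by (rule reducible_cong) simp
  next
    case (mult f g)
    from mult.IH(1) obtain B c where 1: "finite B" "B \<subseteq> exponents m q"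
        "\<forall>A\<in>carrier_mat m q. f A = (\<Sum>b\<in>B. c b * monomial m q b A)"
      by (rule plain)
    from mult.IH(2) obtain B' c' where 2: "finite B'" "B' \<subseteq> exponents m q"
        "\<forall>A\<in>carrier_mat m q. g A = (\<Sum>b\<in>B'. c' b * monomial m q b A)"
      by (rule plain)
    have "reducible_to m q (exponents m q) ?J
        (\<lambda>A. \<Sum>b\<in>B. \<Sum>b'\<in>B'. c b * c' b' * monomial m q (\<lambda>p. b p + b' p) A)"
      using 1(2) 2(2)
      by (intro reducible_sum reducible_scale reducible_monomial absorbing_zero) (auto simp: exponents_def subset_iff)
    then show ?case
      by (rule reducible_cong) (simp add: 1(3) 2(3) sum_product monomial_add, intro sum.cong refl, simp add: mult_ac)
  qed
  then show ?thesis by (rule plain) (use that in blast)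
qed

text \<open>
  If the support of \<open>b\<close> contains the diagonal positions of a minor in \<open>J\<close>, then modulo \<open>J\<close> the product
  of these entries may be replaced by the negative of the sum of the other terms of the minor. These
  give monomials of smaller weight, so the rewriting terminates.
\<close>

lemma reduction:
  assumes J: "absorbing m q J" and f: "f \<in> regular_M m q"
    and bad: "\<And>b. b \<in> exponents m q - N \<Longrightarrow> \<exists>r x y.
      (\<forall>t<r. \<forall>s<t. x s < x t \<and> y s < y t) \<and> (\<forall>t<r. b (x t, y t) \<noteq> 0) \<and>
      (\<lambda>A\<in>carrier_mat m q. det (mat r r (\<lambda>(s, t). A $$ (x s, y t)))) \<in> J"
  shows "reducible_to m q N J f"
proof -
  have all_monomials: "reducible_to m q N J (monomial m q b)" if "b \<in> exponents m q" for b
    using that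
  proof (induction "weight m q b" arbitrary: b rule: less_induct)
    case less
    show ?case
    proof (cases "b \<in> N")
      case True
      then show ?thesis using J by (rule reducible_monomial[rotated])
    next
      case False
      then obtain r x y where inc: "\<forall>t<r. \<forall>s<t. x s < x t \<and> y s < y t"
        and pos: "\<forall>t<r. b (x t, y t) \<noteq> 0"
        and minor: "(\<lambda>A\<in>carrier_mat m q. det (mat r r (\<lambda>(s, t). A $$ (x s, y t)))) \<in> J"
        using bad less.prems by blast
      have grid: "x t < m \<and> y t < q" if "t < r" for t
      proof (rule ccontr)
        assume "\<not> (x t < m \<and> y t < q)"
        then have "b (x t, y t) = 0" using less.prems by (auto simp: exponents_def)
        with pos that show False by blast
      qed
      (* The positions of the term of the minor that belongs to \<pi>; b' is what remains of b when the
         diagonal is removed. *)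
      define P where "P \<pi> = (\<lambda>t. (x t, y (\<pi> t))) ` {0..<r}" for \<pi> :: "nat \<Rightarrow> nat"
      let ?Perm = "{\<pi>. \<pi> permutes {0..<r}}"
      have inj: "inj_on (\<lambda>t. (x t, y (\<pi> t))) {0..<r}" for \<pi> :: "nat \<Rightarrow> nat"
      proof (rule inj_onI)
        fix s t assume "s \<in> {0..<r}" "t \<in> {0..<r}" "(x s, y (\<pi> s)) = (x t, y (\<pi> t))"
        then show "s = t" using inc
          by (metis atLeastLessThan_iff less_irrefl linorder_neqE_nat prod.inject)
      qed
      have Pgrid: "P \<pi> \<subseteq> {..<m} \<times> {..<q}" if "\<pi> \<in> ?Perm" for \<pi>
        using that grid permutes_in_image by (fastforce simp: P_def)
      have monoP: "monomial m q (\<lambda>p. of_bool (p \<in> P \<pi>)) A = (\<Prod>t = 0..<r. A $$ (x t, y (\<pi> t)))"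
        if "\<pi> \<in> ?Perm" for \<pi> and A :: "'a mat"
        unfolding monomial_of_bool[OF Pgrid[OF that]] unfolding P_def by (simp add: prod.reindex[OF inj])
      have weightP: "weight m q (\<lambda>p. of_bool (p \<in> P \<pi>)) = (\<Sum>t = 0..<r. (x t + 1) * (y (\<pi> t) + 1))"
        if "\<pi> \<in> ?Perm" for \<pi>
        unfolding weight_of_bool[OF Pgrid[OF that]] unfolding P_def by (simp add: sum.reindex[OF inj])
      have id: "id \<in> ?Perm" by (simp add: permutes_id)
      define b' where "b' p = b p - of_bool (p \<in> P id)" for p
      have b: "b = (\<lambda>p. b' p + of_bool (p \<in> P id))"
      proof
        fix p show "b p = b' p + of_bool (p \<in> P id)"
        proof (cases "p \<in> P id")
          case True
          then obtain t where "p = (x t, y t)" "t < r" by (auto simp: P_def)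
          then have "b p \<noteq> 0" using pos by simp
          then show ?thesis using True by (simp add: b'_def)
        qed (simp add: b'_def)
      qed
      define b\<pi> where "b\<pi> \<pi> = (\<lambda>p. b' p + of_bool (p \<in> P \<pi>))" for \<pi>
      have ex: "b\<pi> \<pi> \<in> exponents m q" if "\<pi> \<in> ?Perm" for \<pi>
        using less.prems Pgrid[OF that] by (auto simp: b\<pi>_def b'_def exponents_def)
      have lower: "weight m q (b\<pi> \<pi>) < weight m q b" if "\<pi> \<in> ?Perm - {id}" for \<pi>
      proof -
        have "(\<Sum>t = 0..<r. (x t + 1) * (y (\<pi> t) + 1)) < (\<Sum>t = 0..<r. (x t + 1) * (y t + 1))"
          by (rule rearrangement_strict[of r "\<lambda>t. x t + 1" "\<lambda>t. y t + 1"]) (use inc that in auto)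
        then show ?thesis using that
          by (subst b) (simp add: b\<pi>_def weight_add weightP weightP[OF id])
      qed
      have "monomial m q b A = monomial m q b' A * det (mat r r (\<lambda>(s, t). A $$ (x s, y t)))
          + (\<Sum>\<pi>\<in>?Perm - {id}. - signof \<pi> * monomial m q (b\<pi> \<pi>) A)" for A :: "'a mat"
      proof -
        have "det (mat r r (\<lambda>(s, t). A $$ (x s, y t))) =
            (\<Sum>\<pi>\<in>?Perm. signof \<pi> * (\<Prod>t = 0..<r. A $$ (x t, y (\<pi> t))))"
          by (subst det_def'[of _ r]) (auto intro!: sum.cong prod.cong arg_cong2[where f = "(*)"] dest: permutes_in_image)
        also have "\<dots> = (\<Sum>\<pi>\<in>?Perm. signof \<pi> * monomial m q (\<lambda>p. of_bool (p \<in> P \<pi>)) A)"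
          by (intro sum.cong refl) (simp add: monoP)
        also have "\<dots> = monomial m q (\<lambda>p. of_bool (p \<in> P id)) A +
            (\<Sum>\<pi>\<in>?Perm - {id}. signof \<pi> * monomial m q (\<lambda>p. of_bool (p \<in> P \<pi>)) A)"
          by (subst sum.remove[OF _ id]) (auto simp: finite_permutations)
        finally show ?thesis
          by (subst b) (simp add: b\<pi>_def monomial_add distrib_left sum_distrib_left sum_negf mult_ac)
      qed
      moreover have "reducible_to m q N J (\<lambda>A. monomial m q b' A * det (mat r r (\<lambda>(s, t). A $$ (x s, y t)))
          + (\<Sum>\<pi>\<in>?Perm - {id}. - signof \<pi> * monomial m q (b\<pi> \<pi>) A))"
      proof (intro reducible_add[OF J] reducible_sum[OF J] reducible_scale[OF J])
        have "(\<lambda>A\<in>carrier_mat m q. (\<lambda>A\<in>carrier_mat m q. monomial m q b' A) A *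
            (\<lambda>A\<in>carrier_mat m q. det (mat r r (\<lambda>(s, t). A $$ (x s, y t)))) A) \<in> J"
          using J minor regular_monomial unfolding absorbing_def by blast
        from reducible_absorbed[OF this]
        show "reducible_to m q N J (\<lambda>A. monomial m q b' A * det (mat r r (\<lambda>(s, t). A $$ (x s, y t))))"
          by (rule reducible_cong) simp
        show "reducible_to m q N J (monomial m q (b\<pi> \<pi>))" if "\<pi> \<in> ?Perm - {id}" for \<pi>
          using less.hyps[OF lower[OF that] ex] that by blast
      qed
      ultimately show ?thesis by (auto intro: reducible_cong)
    qed
  qed
  obtain B c where B: "finite B" "B \<subseteq> exponents m q"
    "\<And>A. A \<in> carrier_mat m q \<Longrightarrow> f A = (\<Sum>b\<in>B. c b * monomial m q b A)"
    using polynomial_expansion[OF f] by blast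
  have "reducible_to m q N J (\<lambda>A. \<Sum>b\<in>B. c b * monomial m q b A)"
    using B(2) all_monomials by (intro reducible_sum reducible_scale J) auto
  then show ?thesis by (rule reducible_cong) (simp add: B(3))
qed

section \<open>The determinantal ideal\<close>

lemma function_ring_cring:
  fixes F :: "('p \<Rightarrow> 'k :: comm_ring_1) set"
  assumes ext: "\<And>f. f \<in> F \<Longrightarrow> restrict f S = f"
    and const: "\<And>c. (\<lambda>x\<in>S. c) \<in> F"
    and add: "\<And>f g. f \<in> F \<Longrightarrow> g \<in> F \<Longrightarrow> (\<lambda>x\<in>S. f x + g x) \<in> F"
    and mult: "\<And>f g. f \<in> F \<Longrightarrow> g \<in> F \<Longrightarrow> (\<lambda>x\<in>S. f x * g x) \<in> F"
  shows "cring (function_ring S F)"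
proof (rule cringI)
  have id: "(\<lambda>x\<in>S. f x) = f" if "f \<in> F" for f using ext[OF that] by simp
  have eqI: "(\<lambda>x\<in>S. h x) = (\<lambda>x\<in>S. h' x)" if "\<And>x. x \<in> S \<Longrightarrow> h x = h' x" for h h' :: "'p \<Rightarrow> 'k"
    using that by (rule restrict_ext)
  show "abelian_group (function_ring S F)"
  proof (rule abelian_groupI)
    fix f assume "f \<in> carrier (function_ring S F)"
    then have f: "f \<in> F" by (simp add: function_ring_def)
    have "(\<lambda>x\<in>S. (\<lambda>x\<in>S. - 1) x * f x) \<in> F" by (rule mult[OF const f])
    then show "\<exists>g\<in>carrier (function_ring S F). g \<oplus>\<^bsub>function_ring S F\<^esub> f = \<zero>\<^bsub>function_ring S F\<^esub>"
      by (intro bexI[of _ "\<lambda>x\<in>S. (\<lambda>x\<in>S. - 1) x * f x"]) (auto simp: function_ring_def intro!: eqI)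
    show "\<zero>\<^bsub>function_ring S F\<^esub> \<oplus>\<^bsub>function_ring S F\<^esub> f = f"
      using id[OF f] by (auto simp: function_ring_def cong: restrict_cong)
  qed (auto simp: function_ring_def add const algebra_simps cong: restrict_cong)
  show "Group.comm_monoid (function_ring S F)"
  proof (rule comm_monoidI)
    fix f assume "f \<in> carrier (function_ring S F)"
    then have f: "f \<in> F" by (simp add: function_ring_def)
    show "\<one>\<^bsub>function_ring S F\<^esub> \<otimes>\<^bsub>function_ring S F\<^esub> f = f"
      using id[OF f] by (auto simp: function_ring_def cong: restrict_cong)
  qed (auto simp: function_ring_def mult const algebra_simps cong: restrict_cong)
qed (auto simp: function_ring_def algebra_simps cong: restrict_cong)

lemma regular_cring: "cring (function_ring S (regular_functions S C))"
  by (rule function_ring_cring) (auto intro: regular_functions.intros regular_restrict)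

abbreviation minor_at :: "nat \<Rightarrow> (nat \<Rightarrow> nat) \<Rightarrow> (nat \<Rightarrow> nat) \<Rightarrow> 'k :: comm_ring_1 mat \<Rightarrow> 'k" where
  "minor_at r x y A \<equiv> det (mat r r (\<lambda>(s, t). A $$ (x s, y t)))"

lemma submatrix_pick:
  assumes "A \<in> carrier_mat m q" "I \<subseteq> {..<m}" "J \<subseteq> {..<q}" "card I = r" "card J = r"
  shows "submatrix A I J = mat r r (\<lambda>(s, t). A $$ (pick I s, pick J t))"
proof -
  have "{i. i < dim_row A \<and> i \<in> I} = I" "{j. j < dim_col A \<and> j \<in> J} = J" using assms by auto
  then show ?thesis unfolding submatrix_def using assms by simp
qed

text \<open>
  Listing rows in the order given by \<open>x\<close> instead of increasingly permutes the rows of the minor. The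
  sign \<open>\<epsilon>\<close> depends on \<open>x\<close> only, which allows the same statement to be used for columns.
\<close>

lemma det_row_selection:
  fixes x :: "nat \<Rightarrow> nat"
  assumes "inj_on x {0..<r}"
  shows "\<exists>\<epsilon>. \<forall>F. det (mat r r (\<lambda>(s, t). F (x s) t :: 'k :: comm_ring_1))
    = \<epsilon> * det (mat r r (\<lambda>(s, t). F (pick (x ` {0..<r}) s) t))"
proof -
  let ?I = "x ` {0..<r}"
  have card: "card ?I = r" using card_image[OF assms] by simp
  have pinj: "inj_on (pick ?I) {0..<r}"
  proof (rule inj_onI)
    fix s t assume "s \<in> {0..<r}" "t \<in> {0..<r}" "pick ?I s = pick ?I t"
    then show "s = t" using pick_mono_le[of s ?I t] pick_mono_le[of t ?I s] card
      by (metis atLeastLessThan_iff less_irrefl linorder_neqE_nat)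
  qed
  have "pick ?I ` {0..<r} \<subseteq> ?I" using pick_in_set_le[of _ ?I] card by fastforce
  then have pimg: "pick ?I ` {0..<r} = ?I"
    using card_subset_eq[of ?I "pick ?I ` {0..<r}"] card_image[OF pinj] card by simp
  define p where "p s = (if s \<in> {0..<r} then inv_into {0..<r} (pick ?I) (x s) else s)" for s
  have px: "pick ?I (p s) = x s" "p s \<in> {0..<r}" if "s \<in> {0..<r}" for s
    using that pimg f_inv_into_f[of "x s" "pick ?I" "{0..<r}"] inv_into_into[of "x s" "pick ?I" "{0..<r}"]
    by (auto simp: p_def)
  have "inj_on p {0..<r}"
    by (rule inj_onI) (metis assms inj_onD px(1))
  moreover have "p ` {0..<r} \<subseteq> {0..<r}" using px(2) by blast
  ultimately have "bij_betw p {0..<r} {0..<r}"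
    by (simp add: bij_betw_def endo_inj_surj)
  then have p: "p permutes {0..<r}" by (rule bij_imp_permutes) (auto simp: p_def)
  have "det (mat r r (\<lambda>(s, t). F (x s) t)) = signof p * det (mat r r (\<lambda>(s, t). F (pick ?I s) t))"
    for F :: "nat \<Rightarrow> nat \<Rightarrow> 'k"
  proof -
    have "mat r r (\<lambda>(s, t). F (x s) t) = mat r r (\<lambda>(s, t). mat r r (\<lambda>(s, t). F (pick ?I s) t) $$ (p s, t))"
      using px by (intro eq_matI) auto
    then show ?thesis by (simp add: det_permute_rows[OF _ p])
  qed
  then show ?thesis by blast
qed

lemma det_transposed: "det (mat r r (\<lambda>(s, t). F t s)) = det (mat r r (\<lambda>(s, t). F s t :: 'k :: comm_ring_1))"
proof -
  have "transpose_mat (mat r r (\<lambda>(s, t). F s t)) = mat r r (\<lambda>(s, t). F t s)" by (intro eq_matI) auto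
  then show ?thesis using det_transpose[of "mat r r (\<lambda>(s, t). F s t)" r] by simp
qed

text \<open>
  Minors on arbitrary, possibly unsorted or repeated, rows and columns are easier to handle than those
  indexed by sets. Nothing new arises: repetitions give zero, and reordering gives a sign.
\<close>

lemma minor_at_multiple:
  assumes "\<And>t. t < r \<Longrightarrow> x t < m" "\<And>t. t < r \<Longrightarrow> y t < q"
  shows "\<exists>\<epsilon> :: 'k :: comm_ring_1. \<exists>h\<in>minors r m q \<union> {\<lambda>A\<in>carrier_mat m q. 0}.
    \<forall>A\<in>carrier_mat m q. minor_at r x y A = \<epsilon> * h A"
proof (cases "inj_on x {0..<r} \<and> inj_on y {0..<r}")
  case True
  let ?I = "x ` {0..<r}" and ?J = "y ` {0..<r}"
  obtain \<epsilon> :: 'k where 1: "\<And>F. det (mat r r (\<lambda>(s, t). F (x s) t)) = \<epsilon> * det (mat r r (\<lambda>(s, t). F (pick ?I s) t))"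
    using det_row_selection[of x r] True by blast
  obtain \<epsilon>' :: 'k where 2: "\<And>F. det (mat r r (\<lambda>(s, t). F (y s) t)) = \<epsilon>' * det (mat r r (\<lambda>(s, t). F (pick ?J s) t))"
    using det_row_selection[of y r] True by blast
  have IJ: "?I \<subseteq> {..<m}" "?J \<subseteq> {..<q}" "card ?I = r" "card ?J = r"
    using assms True by (auto simp: card_image)
  have "minor_at r x y A = \<epsilon> * \<epsilon>' * det (submatrix A ?I ?J)" if A: "A \<in> carrier_mat m q" for A :: "'k mat"
  proof -
    have "minor_at r x y A = \<epsilon> * minor_at r (pick ?I) y A"
      using 1[of "\<lambda>s t. A $$ (s, y t)"] .
    also have "minor_at r (pick ?I) y A = \<epsilon>' * minor_at r (pick ?I) (pick ?J) A"
      using 2[of "\<lambda>t s. A $$ (pick ?I s, t)"]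
      by (simp add: det_transposed[of r "\<lambda>s t. A $$ (pick ?I s, y t)"]
          det_transposed[of r "\<lambda>s t. A $$ (pick ?I s, pick ?J t)"])
    finally show ?thesis using submatrix_pick[OF A IJ] by (simp add: mult.assoc)
  qed
  moreover have "(\<lambda>A\<in>carrier_mat m q. det (submatrix A ?I ?J)) \<in> minors r m q"
    using IJ unfolding minors_def by blast
  ultimately show ?thesis
    by (intro exI[of _ "\<epsilon> * \<epsilon>'"] bexI[of _ "\<lambda>A\<in>carrier_mat m q. det (submatrix A ?I ?J)"]) auto
next
  case False
  have "minor_at r x y A = 0" for A :: "'k mat"
  proof (cases "inj_on x {0..<r}")
    case True
    then obtain s t where st: "s < r" "t < r" "s \<noteq> t" "y s = y t" using False by (auto simp: inj_on_def)
    then show ?thesis by (intro det_identical_columns[of _ r s t]) auto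
  next
    case False
    then obtain s t where st: "s < r" "t < r" "s \<noteq> t" "x s = x t" by (auto simp: inj_on_def)
    then show ?thesis by (intro det_identical_rows[of _ r s t]) auto
  qed
  then show ?thesis by (intro exI[of _ 0] bexI[of _ "\<lambda>A\<in>carrier_mat m q. 0"]) auto
qed

lemma regular_minor_at:
  assumes "\<And>t. t < r \<Longrightarrow> x t < m" "\<And>t. t < r \<Longrightarrow> y t < q"
  shows "restrict (minor_at r x y) (carrier_mat m q) \<in> regular_M m q"
  using assms by (intro regular_det regular_entry) auto

lemma minors_regular: "minors r m q \<subseteq> regular_M m q"
proof
  fix h :: "'a mat \<Rightarrow> 'a" assume "h \<in> minors r m q"
  then obtain I J where h: "h = (\<lambda>A\<in>carrier_mat m q. det (submatrix A I J))"
    and IJ: "I \<subseteq> {..<m}" "J \<subseteq> {..<q}" "card I = r" "card J = r" unfolding minors_def by blast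
  have "h = restrict (minor_at r (pick I) (pick J)) (carrier_mat m q)"
    unfolding h by (intro restrict_ext) (simp add: submatrix_pick[OF _ IJ])
  also have "\<dots> \<in> regular_M m q"
  proof (rule regular_minor_at)
    fix t assume "t < r"
    then show "pick I t < m" "pick J t < q"
      using pick_in_set_le[of t I] pick_in_set_le[of t J] IJ by auto
  qed
  finally show "h \<in> regular_M m q" .
qed

lemma matrix_ring_simps:
  "carrier (matrix_ring m q) = regular_M m q"
  "f \<otimes>\<^bsub>matrix_ring m q\<^esub> g = (\<lambda>A\<in>carrier_mat m q. f A * g A)"
  "f \<oplus>\<^bsub>matrix_ring m q\<^esub> g = (\<lambda>A\<in>carrier_mat m q. f A + g A)"
  "\<zero>\<^bsub>matrix_ring m q\<^esub> = (\<lambda>A\<in>carrier_mat m q. 0)"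
  "\<one>\<^bsub>matrix_ring m q\<^esub> = (\<lambda>A\<in>carrier_mat m q. 1)"
  by (simp_all add: matrix_ring_def function_ring_def)

lemma matrix_ring_cring: "cring (matrix_ring m q)"
  unfolding matrix_ring_def by (rule regular_cring)

lemma determinantal_ideal_ideal: "ideal (determinantal_ideal r m q) (matrix_ring m q :: ('k :: comm_ring_1 mat \<Rightarrow> 'k) ring)"
  unfolding determinantal_ideal_def
  by (intro ring.genideal_ideal cring.axioms(1) matrix_ring_cring)
    (simp add: matrix_ring_simps minors_regular)

lemma minors_in_determinantal_ideal: "minors r m q \<subseteq> determinantal_ideal r m q"
  unfolding determinantal_ideal_def
  by (intro ring.genideal_self cring.axioms(1) matrix_ring_cring)
    (simp add: matrix_ring_simps minors_regular)

lemma absorbing_ideal: "ideal J (matrix_ring m q) \<Longrightarrow> absorbing m q J"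
  unfolding absorbing_def
  using additive_subgroup.zero_closed[OF ideal.axioms(1), of J "matrix_ring m q"]
    additive_subgroup.a_closed[OF ideal.axioms(1), of J "matrix_ring m q"]
    ideal.I_l_closed[of J "matrix_ring m q"]
  by (simp add: matrix_ring_simps)

lemma minor_at_in_determinantal_ideal:
  assumes "\<And>t. t < r \<Longrightarrow> x t < m" "\<And>t. t < r \<Longrightarrow> y t < q"
  shows "restrict (minor_at r x y) (carrier_mat m q) \<in> (determinantal_ideal r m q :: ('k :: comm_ring_1 mat \<Rightarrow> 'k) set)"
proof -
  obtain \<epsilon> :: 'k and h where h: "h \<in> minors r m q \<union> {\<lambda>A\<in>carrier_mat m q. 0}"
    and e: "\<forall>A\<in>carrier_mat m q. minor_at r x y A = \<epsilon> * h A"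
  proof -
    have "\<exists>\<epsilon> :: 'k. \<exists>h\<in>minors r m q \<union> {\<lambda>A\<in>carrier_mat m q. 0}.
      \<forall>A\<in>carrier_mat m q. minor_at r x y A = \<epsilon> * h A" using assms by (rule minor_at_multiple)
    then show thesis by (elim exE bexE) (rule that)
  qed
  note J = absorbing_ideal[OF determinantal_ideal_ideal[of r m q]]
  have "h \<in> determinantal_ideal r m q"
    using h J minors_in_determinantal_ideal[of r m q] unfolding absorbing_def by blast
  moreover have "(\<lambda>A\<in>carrier_mat m q. \<epsilon>) \<in> regular_M m q" by (rule regular_functions.const)
  ultimately have "(\<lambda>A\<in>carrier_mat m q. (\<lambda>A\<in>carrier_mat m q. \<epsilon>) A * h A) \<in> determinantal_ideal r m q"
    using J unfolding absorbing_def by metis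
  moreover have "(\<lambda>A\<in>carrier_mat m q. (\<lambda>A\<in>carrier_mat m q. \<epsilon>) A * h A) = restrict (minor_at r x y) (carrier_mat m q)"
    using e by (intro restrict_ext) simp
  ultimately show ?thesis by simp
qed

section \<open>Coordinates of points\<close>

text \<open>
  The points with coordinates \<open>x (Inl (i, k))\<close> for the vectors and \<open>x (Inr (j, k))\<close> for the functionals.
  A single assignment for all coordinates turns functions on the variety into polynomials in \<open>x\<close>.
\<close>

definition point_of :: "nat \<Rightarrow> nat \<Rightarrow> nat \<Rightarrow> (nat \<times> nat + nat \<times> nat \<Rightarrow> 'k) \<Rightarrow> 'k :: comm_ring_1 point" where
  "point_of n m q x = (\<lambda>i\<in>{..<m}. vec n (\<lambda>k. x (Inl (i, k))),
     \<lambda>j\<in>{..<q}. \<lambda>v\<in>carrier_vec n. \<Sum>k<n. x (Inr (j, k)) * v $ k)"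

lemma linear_form_in_dual_space: "(\<lambda>v\<in>carrier_vec n. \<Sum>k<n. a k * v $ k) \<in> dual_space n"
  by (auto simp: dual_space_def distrib_left sum.distrib sum_distrib_left mult_ac)

lemma point_of_in_X: "point_of n m q x \<in> X_points n m q"
  by (auto simp: point_of_def X_points_def linear_form_in_dual_space)

lemma dual_space_coordinates:
  assumes "\<xi> \<in> dual_space n" "v \<in> carrier_vec n"
  shows "\<xi> v = (\<Sum>k<n. \<xi> (unit_vec n k) * v $ k)"
proof -
  have add: "\<xi> (v + w) = \<xi> v + \<xi> w" if "v \<in> carrier_vec n" "w \<in> carrier_vec n" for v w
    using assms(1) that by (auto simp: dual_space_def)
  have smult: "\<xi> (c \<cdot>\<^sub>v v) = c * \<xi> v" if "v \<in> carrier_vec n" for c v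
    using assms(1) that by (auto simp: dual_space_def)
  have "\<xi> (vec n (\<lambda>k. if k < N then v $ k else 0)) = (\<Sum>k<N. \<xi> (unit_vec n k) * v $ k)" if "N \<le> n" for N
    using that
  proof (induction N)
    case 0
    have "vec n (\<lambda>k. if k < 0 then v $ k else 0) = 0 \<cdot>\<^sub>v 0\<^sub>v n" by (intro eq_vecI) auto
    then show ?case using smult[of "0\<^sub>v n" 0] by simp
  next
    case (Suc N)
    have "vec n (\<lambda>k. if k < Suc N then v $ k else 0)
        = vec n (\<lambda>k. if k < N then v $ k else 0) + (v $ N) \<cdot>\<^sub>v unit_vec n N"
      using Suc.prems by (intro eq_vecI) (auto simp: less_Suc_eq)
    then show ?case using Suc add smult by (simp add: mult.commute)
  qed
  from this[of n] have "\<xi> (vec n (\<lambda>k. if k < n then v $ k else 0)) = (\<Sum>k<n. \<xi> (unit_vec n k) * v $ k)" by simp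
  moreover have "vec n (\<lambda>k. if k < n then v $ k else 0) = v" using assms(2) by (intro eq_vecI) auto
  ultimately show ?thesis by simp
qed

lemma X_point_cases:
  assumes "p \<in> X_points n m q"
  obtains x where "p = point_of n m q x"
proof -
  obtain u \<xi> where p: "p = (u, \<xi>)" "u \<in> {..<m} \<rightarrow>\<^sub>E carrier_vec n" "\<xi> \<in> {..<q} \<rightarrow>\<^sub>E dual_space n"
    using assms by (auto simp: X_points_def)
  define x where "x = case_sum (\<lambda>(i, k). u i $ k) (\<lambda>(j, k). \<xi> j (unit_vec n k))"
  have "u = (\<lambda>i\<in>{..<m}. vec n (\<lambda>k. x (Inl (i, k))))"
  proof (rule PiE_ext[OF p(2)])
    show "u i = (\<lambda>i\<in>{..<m}. vec n (\<lambda>k. x (Inl (i, k)))) i" if "i \<in> {..<m}" for i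
      using PiE_mem[OF p(2) that] that by (intro eq_vecI) (auto simp: x_def)
  qed auto
  moreover have "\<xi> = (\<lambda>j\<in>{..<q}. \<lambda>v\<in>carrier_vec n. \<Sum>k<n. x (Inr (j, k)) * v $ k)"
  proof (rule PiE_ext[OF p(3)])
    show "\<xi> j = (\<lambda>j\<in>{..<q}. \<lambda>v\<in>carrier_vec n. \<Sum>k<n. x (Inr (j, k)) * v $ k) j" if "j \<in> {..<q}" for j
    proof -
      have "\<xi> j \<in> dual_space n" using PiE_mem[OF p(3) that] .
      moreover have "\<xi> j = restrict (\<xi> j) (carrier_vec n)"
        using PiE_mem[OF p(3) that] by (auto simp: dual_space_def PiE_restrict)
      ultimately have "\<xi> j = (\<lambda>v\<in>carrier_vec n. \<Sum>k<n. \<xi> j (unit_vec n k) * v $ k)"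
        using dual_space_coordinates[of "\<xi> j" n] by (metis (no_types, lifting) restrict_ext)
      then show ?thesis using that by (simp add: x_def)
    qed
  qed (auto simp: linear_form_in_dual_space)
  ultimately show ?thesis using that[of x] p(1) by (simp add: point_of_def)
qed

lemma \<psi>_point_of:
  "\<psi> n m q (point_of n m q x) = mat m q (\<lambda>(i, j). \<Sum>k<n. x (Inl (i, k)) * x (Inr (j, k)))"
  using point_of_in_X[of n m q x] unfolding \<psi>_def
  by (auto simp: point_of_def mult.commute intro!: eq_matI)

lemma \<psi>_carrier: "p \<in> X_points n m q \<Longrightarrow> \<psi> n m q p \<in> carrier_mat m q"
  by (erule X_point_cases) (simp add: \<psi>_point_of)

lemma point_of_coordinates:
  assumes "k < n"
  shows "i < m \<Longrightarrow> fst (point_of n m q x) i $ k = x (Inl (i, k))"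
    and "j < q \<Longrightarrow> snd (point_of n m q x) j (unit_vec n k) = x (Inr (j, k))"
proof -
  have "(\<Sum>k'<n. x (Inr (j, k')) * unit_vec n k $ k') = (\<Sum>k'\<in>{k}. x (Inr (j, k')) * unit_vec n k $ k')"
    using assms by (intro sum.mono_neutral_right) auto
  then show "j < q \<Longrightarrow> snd (point_of n m q x) j (unit_vec n k) = x (Inr (j, k))"
    using assms by (simp add: point_of_def)
qed (use assms in \<open>simp add: point_of_def\<close>)

lemma pullback_regular:
  assumes "\<And>g. g \<in> C' \<Longrightarrow> pullback S \<phi> (restrict g T) \<in> regular_functions S C"
    and maps: "\<And>x. x \<in> S \<Longrightarrow> \<phi> x \<in> T"
    and "f \<in> regular_functions T C'"
  shows "pullback S \<phi> f \<in> regular_functions S C"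
  using assms(3)
proof (induction rule: regular_functions.induct)
  case (const c)
  have "pullback S \<phi> (\<lambda>x\<in>T. c) = (\<lambda>x\<in>S. c)" unfolding pullback_def by (intro restrict_ext) (simp add: maps)
  then show ?case by (simp only: regular_functions.const)
next
  case (coord f)
  then show ?case by (rule assms(1))
next
  case (add f g)
  have "pullback S \<phi> (\<lambda>x\<in>T. f x + g x) = (\<lambda>x\<in>S. pullback S \<phi> f x + pullback S \<phi> g x)"
    unfolding pullback_def by (intro restrict_ext) (simp add: maps)
  then show ?case using regular_functions.add[OF add.IH] by (simp only:)
next
  case (mult f g)
  have "pullback S \<phi> (\<lambda>x\<in>T. f x * g x) = (\<lambda>x\<in>S. pullback S \<phi> f x * pullback S \<phi> g x)"
    unfolding pullback_def by (intro restrict_ext) (simp add: maps)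
  then show ?case using regular_functions.mult[OF mult.IH] by (simp only:)
qed

lemma regular_X_coordinates:
  assumes "k < n"
  shows "i < m \<Longrightarrow> (\<lambda>p\<in>X_points n m q. fst p i $ k) \<in> regular_X n m q"
    and "j < q \<Longrightarrow> (\<lambda>p\<in>X_points n m q. snd p j (unit_vec n k)) \<in> regular_X n m q"
  unfolding regular_X_def using assms
  by (intro regular_functions.coord, force simp: X_coordinates_def case_prod_beta)+

lemma \<psi>_pullback_regular:
  assumes "f \<in> regular_M m q"
  shows "pullback (X_points n m q) (\<psi> n m q) f \<in> regular_X n m q"
  unfolding regular_X_def
proof (rule pullback_regular[OF _ \<psi>_carrier assms])
  fix g :: "'a mat \<Rightarrow> 'a" assume "g \<in> matrix_coordinates m q"
  then obtain i j where g: "g = (\<lambda>A. A $$ (i, j))" "i < m" "j < q" by (auto simp: matrix_coordinates_def)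
  have "(\<lambda>p\<in>X_points n m q. \<Sum>k<n. fst p i $ k * snd p j (unit_vec n k)) \<in> regular_X n m q"
    unfolding regular_X_def using regular_X_coordinates g(2,3)
    by (intro regular_sum regular_mult) (auto simp: regular_X_def)
  moreover have "pullback (X_points n m q) (\<psi> n m q) (restrict g (carrier_mat m q))
     = (\<lambda>p\<in>X_points n m q. \<Sum>k<n. fst p i $ k * snd p j (unit_vec n k))"
    unfolding pullback_def
  proof (rule restrict_ext)
    fix p :: "'a point" assume "p \<in> X_points n m q"
    then obtain x where p: "p = point_of n m q x" by (rule X_point_cases)
    then show "restrict g (carrier_mat m q) (\<psi> n m q p) = (\<Sum>k<n. fst p i $ k * snd p j (unit_vec n k))"
      using g by (simp add: \<psi>_point_of point_of_coordinates)
  qed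
  ultimately show "pullback (X_points n m q) (\<psi> n m q) (restrict g (carrier_mat m q))
     \<in> regular_functions (X_points n m q) (X_coordinates n m q)"
    by (simp add: regular_X_def)
qed

section \<open>The kernel of the pullback\<close>

lemma infinite_alg_closed_field: "infinite (UNIV :: 'k :: alg_closed_field set)"
proof
  assume fin: "finite (UNIV :: 'k set)"
  define p where "p = (\<Prod>a\<in>(UNIV :: 'k set). [:- a, 1:])"
  have "degree p = (\<Sum>a\<in>(UNIV :: 'k set). degree [:- a, 1:])"
    unfolding p_def by (rule degree_prod_eq_sum_degree) auto
  then have deg: "degree p > 0" using fin by (simp add: card_gt_0_iff)
  then have "degree (p + 1) > 0" by (subst degree_add_eq_left) auto
  then obtain x where "poly (p + 1) x = 0" using alg_closed_imp_poly_has_root by blast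
  moreover have "poly p x = 0" unfolding p_def poly_prod using fin by (intro prod_zero) auto
  ultimately show False by simp
qed

text \<open>
  The matrix factors through dimension \<open>n < r\<close>; padding the factors with zeros makes them square and
  the first one singular.
\<close>

lemma det_low_rank_product:
  assumes "n < r"
  shows "det (mat r r (\<lambda>(s, t). \<Sum>k<n. F s k * H k t)) = (0 :: 'k :: comm_ring_1)"
proof -
  let ?F = "mat r r (\<lambda>(s, k). if k < n then F s k else 0)"
  let ?H = "mat r r (\<lambda>(k, t). if k < n then H k t else 0)"
  have "(\<Sum>k<n. F s k * H k t) = (\<Sum>k = 0..<r. (if k < n then F s k else 0) * (if k < n then H k t else 0))" for s t
    using assms by (intro sum.mono_neutral_cong_left) auto
  then have "mat r r (\<lambda>(s, t). \<Sum>k<n. F s k * H k t) = ?F * ?H"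
    by (intro eq_matI) (auto simp: scalar_prod_def intro!: sum.cong)
  moreover have "det ?F = 0"
    by (subst laplace_expansion_column[of _ r n]) (use assms in auto)
  ultimately show ?thesis by (simp add: det_mult[of _ r])
qed

lemma X_ring_simps:
  "carrier (X_ring n m q) = regular_X n m q"
  "f \<otimes>\<^bsub>X_ring n m q\<^esub> g = (\<lambda>p\<in>X_points n m q. f p * g p)"
  "f \<oplus>\<^bsub>X_ring n m q\<^esub> g = (\<lambda>p\<in>X_points n m q. f p + g p)"
  "\<zero>\<^bsub>X_ring n m q\<^esub> = (\<lambda>p\<in>X_points n m q. 0)"
  "\<one>\<^bsub>X_ring n m q\<^esub> = (\<lambda>p\<in>X_points n m q. 1)"
  by (simp_all add: X_ring_def function_ring_def)

lemma X_ring_cring: "cring (X_ring n m q)"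
  unfolding X_ring_def regular_X_def by (rule regular_cring)

lemma \<psi>_pullback_hom:
  "ring_hom_ring (matrix_ring m q) (X_ring n m q) (pullback (X_points n m q) (\<psi> n m q))"
proof (rule ring_hom_ringI)
  show "Ring.ring (matrix_ring m q)" "Ring.ring (X_ring n m q)"
    by (intro cring.axioms(1) matrix_ring_cring X_ring_cring)+
qed (use \<psi>_pullback_regular in \<open>auto simp: matrix_ring_simps X_ring_simps pullback_def \<psi>_carrier intro!: restrict_ext\<close>)

lemma determinantal_ideal_vanishes:
  fixes h :: "'k :: comm_ring_1 mat \<Rightarrow> 'k"
  assumes "h \<in> determinantal_ideal (n + 1) m q" "p \<in> X_points n m q"
  shows "h (\<psi> n m q p) = 0"
proof -
  let ?\<phi> = "pullback (X_points n m q) (\<psi> n m q) :: ('k mat \<Rightarrow> 'k) \<Rightarrow> _"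
  interpret hom: ring_hom_ring "matrix_ring m q" "X_ring n m q" ?\<phi> by (rule \<psi>_pullback_hom)
  have "(minors (n + 1) m q :: ('k mat \<Rightarrow> 'k) set) \<subseteq> a_kernel (matrix_ring m q) (X_ring n m q) ?\<phi>"
  proof
    fix h :: "'k mat \<Rightarrow> 'k" assume h: "h \<in> minors (n + 1) m q"
    then obtain I J where hIJ: "h = (\<lambda>A\<in>carrier_mat m q. det (submatrix A I J))"
      and IJ: "I \<subseteq> {..<m}" "J \<subseteq> {..<q}" "card I = n + 1" "card J = n + 1" unfolding minors_def by blast
    have "h (\<psi> n m q p) = 0" if p: "p \<in> X_points n m q" for p
    proof -
      obtain x where x: "p = point_of n m q x" using p by (rule X_point_cases)
      have "pick I t < m" "pick J t < q" if "t < n + 1" for t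
        using pick_in_set_le[of t I] pick_in_set_le[of t J] IJ that by auto
      then have "mat (n + 1) (n + 1) (\<lambda>(s, t). \<psi> n m q p $$ (pick I s, pick J t))
          = mat (n + 1) (n + 1) (\<lambda>(s, t). \<Sum>k<n. x (Inl (pick I s, k)) * x (Inr (pick J t, k)))"
        by (intro eq_matI) (auto simp: x \<psi>_point_of)
      then show ?thesis using det_low_rank_product[of n "n + 1"]
        by (simp add: hIJ \<psi>_carrier[OF p] submatrix_pick[OF \<psi>_carrier[OF p] IJ])
    qed
    then have "?\<phi> h = (\<lambda>p\<in>X_points n m q. 0)" unfolding pullback_def by (intro restrict_ext)
    then show "h \<in> a_kernel (matrix_ring m q) (X_ring n m q) ?\<phi>"
      using h minors_regular unfolding a_kernel_def' by (auto simp: matrix_ring_simps X_ring_simps)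
  qed
  then have "determinantal_ideal (n + 1) m q \<subseteq> a_kernel (matrix_ring m q) (X_ring n m q) ?\<phi>"
    unfolding determinantal_ideal_def by (rule hom.R.genideal_minimal[OF hom.kernel_is_ideal])
  then have "?\<phi> h = (\<lambda>p\<in>X_points n m q. 0)" using assms(1) unfolding a_kernel_def' X_ring_simps by auto
  from fun_cong[OF this, of p] show ?thesis using assms(2) by (simp add: pullback_def)
qed

text \<open>
  If a monomial with nonzero coefficient existed, one of maximal weight would contradict
  \<open>leading_coefficient_vanishes\<close>. The set \<open>Y\<close> of variables that are set to zero may depend on the monomial,
  which is why the sum is assumed to vanish for each \<open>Y\<close> in a family.
\<close>

lemma normal_form_unique:
  fixes c :: "(nat \<times> nat \<Rightarrow> nat) \<Rightarrow> 'k :: alg_closed_field"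
  assumes B: "finite B" "B \<subseteq> exponents m q"
    and coloring: "\<And>a. a \<in> B \<Longrightarrow> \<exists>l. \<exists>Y\<in>\<Y>. (\<forall>p. a p \<noteq> 0 \<longrightarrow> l p < n) \<and>
      (\<forall>p p'. a p \<noteq> 0 \<longrightarrow> a p' \<noteq> 0 \<longrightarrow> below p p' \<longrightarrow> l p \<noteq> l p') \<and>
      (\<forall>p k. a p \<noteq> 0 \<longrightarrow> Inl (fst p, k) \<in> Y \<or> Inr (snd p, k) \<in> Y \<longrightarrow> l p \<noteq> k)"
    and van: "\<And>Y x. Y \<in> \<Y> \<Longrightarrow> \<forall>v\<in>Y. x v = 0 \<Longrightarrow>
      (\<Sum>b\<in>B. c b * monomial m q b (\<psi> n m q (point_of n m q x))) = 0"
    and b: "b \<in> B"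
  shows "c b = 0"
proof (rule ccontr)
  assume "c b \<noteq> 0"
  let ?B = "{b \<in> B. c b \<noteq> 0}"
  have fin: "finite (weight m q ` ?B)" and ne: "weight m q ` ?B \<noteq> {}" using B(1) b \<open>c b \<noteq> 0\<close> by auto
  obtain a where a: "a \<in> ?B" "weight m q a = Max (weight m q ` ?B)" using Max_in[OF fin ne] by auto
  have amax: "weight m q b \<le> weight m q a" if "b \<in> ?B" for b
    unfolding a(2) using fin that by (intro Max_ge) auto
  obtain l Y where Y: "Y \<in> \<Y>" and l: "\<forall>p. a p \<noteq> 0 \<longrightarrow> l p < n"
    "\<forall>p p'. a p \<noteq> 0 \<longrightarrow> a p' \<noteq> 0 \<longrightarrow> below p p' \<longrightarrow> l p \<noteq> l p'"
    "\<forall>p k. a p \<noteq> 0 \<longrightarrow> Inl (fst p, k) \<in> Y \<or> Inr (snd p, k) \<in> Y \<longrightarrow> l p \<noteq> k"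
    using coloring[of a] a(1) by blast
  have "c a = 0"
  proof (rule leading_coefficient_vanishes[where B = ?B and l = l and Y = Y and c = c and m = m and q = q and n = n])
    show "infinite (UNIV :: 'k set)" by (rule infinite_alg_closed_field)
    show "finite ?B" using B(1) by simp
    show "b p = 0" if "b \<in> ?B" "p \<notin> {..<m} \<times> {..<q}" for b p
      using that B(2) unfolding exponents_def by blast
    fix x :: "nat \<times> nat + nat \<times> nat \<Rightarrow> 'k" assume "\<forall>v\<in>Y. x v = 0"
    then have "(\<Sum>b\<in>B. c b * monomial m q b (\<psi> n m q (point_of n m q x))) = 0" by (rule van[OF Y])
    moreover have "(\<Sum>b\<in>?B. c b * (\<Prod>p\<in>{..<m} \<times> {..<q}. (\<Sum>k<n. x (Inl (fst p, k)) * x (Inr (snd p, k))) ^ b p))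
      = (\<Sum>b\<in>B. c b * monomial m q b (\<psi> n m q (point_of n m q x)))"
      using B(1) by (intro sum.mono_neutral_cong_left)
        (auto simp: monomial_def \<psi>_point_of intro!: prod.cong)
    ultimately show "(\<Sum>b\<in>?B. c b * (\<Prod>p\<in>{..<m} \<times> {..<q}.
      (\<Sum>k<n. x (Inl (fst p, k)) * x (Inr (snd p, k))) ^ b p)) = 0" by simp
  qed (use a(1) amax l in \<open>auto simp: below_def\<close>)
  then show False using a(1) by simp
qed

definition chain_free_exponents :: "nat \<Rightarrow> nat \<Rightarrow> nat \<Rightarrow> (nat \<times> nat \<Rightarrow> nat) set" where
  "chain_free_exponents n m q = {b \<in> exponents m q. \<nexists>p. chain_at below {p. b p \<noteq> 0} n p}"

text \<open>
  The rows and columns of a chain of \<open>n + 1\<close> positions in the support of \<open>b\<close> select a minor whose diagonal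
  product divides the monomial.
\<close>

lemma chain_gives_minor:
  assumes b: "b \<in> exponents m q - chain_free_exponents n m q"
  shows "\<exists>r x y. (\<forall>t<r. \<forall>s<t. x s < x t \<and> y s < y t) \<and> (\<forall>t<r. b (x t, y t) \<noteq> 0) \<and>
    (\<lambda>A\<in>carrier_mat m q. minor_at r x y A :: 'k :: comm_ring_1) \<in> determinantal_ideal (n + 1) m q"
proof -
  obtain p where "chain_at below {p. b p \<noteq> 0} n p" using b by (auto simp: chain_free_exponents_def)
  then obtain d where d: "\<forall>t\<le>n. b (d t) \<noteq> 0" "\<forall>t\<le>n. \<forall>s<t. below (d s) (d t)"
    using chain_at_sequence by blast
  have grid: "fst (d t) < m" "snd (d t) < q" if "t < n + 1" for t
  proof -
    have "b (d t) \<noteq> 0" using d(1) that by simp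
    moreover have "b \<in> exponents m q" using b by simp
    ultimately have "d t \<in> {..<m} \<times> {..<q}" unfolding exponents_def mem_Collect_eq by metis
    then show "fst (d t) < m" "snd (d t) < q" by auto
  qed
  have "restrict (minor_at (n + 1) (\<lambda>t. fst (d t)) (\<lambda>t. snd (d t))) (carrier_mat m q)
      \<in> (determinantal_ideal (n + 1) m q :: ('k mat \<Rightarrow> 'k) set)"
    by (rule minor_at_in_determinantal_ideal) (use grid in auto)
  then show ?thesis
    by (intro exI[of _ "n + 1"] exI[of _ "\<lambda>t. fst (d t)"] exI[of _ "\<lambda>t. snd (d t)"])
      (use d in \<open>auto simp: below_def less_Suc_eq_le\<close>)
qed

text \<open>
  Modulo the minors, \<open>f\<close> is a combination of monomials without chains of \<open>n + 1\<close> positions. Levels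
  split each of these into \<open>n\<close> parts without chains of two positions, so all coefficients vanish.
\<close>

theorem second_fundamental_theorem:
  fixes f :: "'k :: alg_closed_field mat \<Rightarrow> 'k"
  assumes f: "f \<in> regular_M m q" and van: "\<And>p. p \<in> X_points n m q \<Longrightarrow> f (\<psi> n m q p) = 0"
  shows "f \<in> determinantal_ideal (n + 1) m q"
proof -
  let ?I = "determinantal_ideal (n + 1) m q :: ('k mat \<Rightarrow> 'k) set"
  have "reducible_to m q (chain_free_exponents n m q) ?I f"
    by (rule reduction[OF absorbing_ideal[OF determinantal_ideal_ideal] f chain_gives_minor])
  then obtain B c h where B: "finite B" "B \<subseteq> chain_free_exponents n m q" and h: "h \<in> ?I"
    and fB: "\<And>A. A \<in> carrier_mat m q \<Longrightarrow> f A = (\<Sum>b\<in>B. c b * monomial m q b A) + h A"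
    unfolding reducible_to_def by blast
  have "c b = 0" if "b \<in> B" for b
  (* The pullback vanishes identically, so no variables need to be set to zero. *)
  proof (rule normal_form_unique[where \<Y> = "{{}}" and n = n, OF B(1) _ _ _ that])
    show "B \<subseteq> exponents m q" using B(2) by (auto simp: chain_free_exponents_def)
    fix a assume "a \<in> B"
    then have short: "\<nexists>p. chain_at below {p. a p \<noteq> 0} n p" using B(2) by (auto simp: chain_free_exponents_def)
    show "\<exists>l. \<exists>Y\<in>{{}}. (\<forall>p. a p \<noteq> 0 \<longrightarrow> l p < n) \<and>
      (\<forall>p p'. a p \<noteq> 0 \<longrightarrow> a p' \<noteq> 0 \<longrightarrow> below p p' \<longrightarrow> l p \<noteq> l p') \<and>
      (\<forall>p k. a p \<noteq> 0 \<longrightarrow> Inl (fst p, k) \<in> Y \<or> Inr (snd p, k) \<in> Y \<longrightarrow> l p \<noteq> k)"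
      using level_less[OF short] level_strict[OF short]
      by (intro exI[of _ "level below {p. a p \<noteq> 0}"]) (simp, metis less_irrefl)
  next
    fix x :: "nat \<times> nat + nat \<times> nat \<Rightarrow> 'k"
    show "(\<Sum>b\<in>B. c b * monomial m q b (\<psi> n m q (point_of n m q x))) = 0"
      using fB[OF \<psi>_carrier[OF point_of_in_X[of n m q x]]] van[OF point_of_in_X[of n m q x]]
        determinantal_ideal_vanishes[OF h point_of_in_X[of n m q x]] by simp
  qed
  then have "f A = h A" if "A \<in> carrier_mat m q" for A using fB[OF that] by simp
  then have "f = h"
    using regular_restrict[OF f] h ideal.Icarr[OF determinantal_ideal_ideal h]
      regular_restrict[of h "carrier_mat m q" "matrix_coordinates m q"]
    by (metis matrix_ring_simps(1) restrict_ext)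
  then show ?thesis using h by simp
qed

section \<open>Division by the corner minor\<close>

text \<open>
  The submatrix sits in the upper right corner, so its diagonal runs from the first row to the last column.
  If a set of positions contains a chain of \<open>n\<close> positions in the first \<open>n\<close> rows and another in the last
  \<open>n\<close> columns, then it contains this diagonal or a chain of \<open>n + 1\<close> positions. This would fail for the
  upper left corner with its first \<open>n\<close> columns, already for \<open>n = 1\<close>.
\<close>

definition corner :: "nat \<Rightarrow> nat \<Rightarrow> 'k :: comm_ring_1 mat \<Rightarrow> 'k" where
  "corner n q A = minor_at n (\<lambda>s. s) (\<lambda>t. q - n + t) A"

lemma corner_regular: "n \<le> m \<Longrightarrow> n \<le> q \<Longrightarrow> restrict (corner n q) (carrier_mat m q) \<in> regular_M m q"
  unfolding corner_def by (rule regular_minor_at) auto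

lemma corner_\<psi>:
  assumes "n \<le> m" "n \<le> q"
  shows "mat n n (\<lambda>(s, t). \<psi> n m q (point_of n m q x) $$ (s, q - n + t))
    = mat n n (\<lambda>(i, k). x (Inl (i, k))) * mat n n (\<lambda>(k, t). x (Inr (q - n + t, k)))"
  using assms by (intro eq_matI) (auto simp: \<psi>_point_of scalar_prod_def lessThan_atLeast0 intro!: sum.cong)

lemma corner_factorization:
  assumes "n \<le> m" "n \<le> q"
  shows "corner n q (\<psi> n m q (point_of n m q x))
    = det (mat n n (\<lambda>(i, k). x (Inl (i, k)))) * det (mat n n (\<lambda>(k, t). x (Inr (q - n + t, k))))"
  unfolding corner_def corner_\<psi>[OF assms] by (rule det_mult[of _ n]) auto

lemma corner_vanishes:
  assumes "0 < n" "n \<le> m" "n \<le> q"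
    and "(\<forall>i<n. x (Inl (i, n - 1)) = 0) \<or> (\<forall>t<n. x (Inr (q - n + t, n - 1)) = 0)"
  shows "corner n q (\<psi> n m q (point_of n m q x)) = 0"
  using assms(4)
proof
  assume "\<forall>i<n. x (Inl (i, n - 1)) = 0"
  then have "det (mat n n (\<lambda>(i, k). x (Inl (i, k)))) = 0"
    by (subst laplace_expansion_column[of _ n "n - 1"]) (use assms(1) in auto)
  then show ?thesis by (simp add: corner_factorization[OF assms(2,3)])
next
  assume "\<forall>t<n. x (Inr (q - n + t, n - 1)) = 0"
  then have "det (mat n n (\<lambda>(k, t). x (Inr (q - n + t, k)))) = 0"
    by (subst laplace_expansion_row[of _ n "n - 1"]) (use assms(1) in auto)
  then show ?thesis by (simp add: corner_factorization[OF assms(2,3)])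
qed

lemma corner_nonzero:
  assumes "n \<le> m" "n \<le> q"
  shows "\<exists>x. corner n q (\<psi> n m q (point_of n m q x)) = (1 :: 'k :: comm_ring_1)"
proof -
  let ?x = "case_sum (\<lambda>(i, k). of_bool (i = k)) (\<lambda>(j, k). of_bool (j = q - n + k)) :: _ \<Rightarrow> 'k"
  have "mat n n (\<lambda>(i, k). ?x (Inl (i, k))) = 1\<^sub>m n" "mat n n (\<lambda>(k, t). ?x (Inr (q - n + t, k))) = 1\<^sub>m n"
    by (auto intro!: eq_matI)
  then show ?thesis using corner_factorization[OF assms, of ?x] by (intro exI[of _ ?x]) simp
qed

lemma regular_on_line:
  assumes "f \<in> regular_X n m q"
  shows "\<exists>P. \<forall>t. f (point_of n m q (\<lambda>v. x v + t * (y v - x v))) = poly P (t :: 'k :: comm_ring_1)"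
  using assms unfolding regular_X_def
proof (induction rule: regular_functions.induct)
  case (const c)
  show ?case by (rule exI[of _ "[:c:]"]) (simp add: point_of_in_X)
next
  case (coord f)
  then obtain v where "\<And>x. f (point_of n m q x) = x v"
    unfolding X_coordinates_def by (force simp: case_prod_beta point_of_coordinates)
  then show ?case by (intro exI[of _ "[:x v, y v - x v:]"]) (simp add: point_of_in_X)
next
  case (add f g)
  then obtain P Q where "\<forall>t. f (point_of n m q (\<lambda>v. x v + t * (y v - x v))) = poly P t"
    "\<forall>t. g (point_of n m q (\<lambda>v. x v + t * (y v - x v))) = poly Q t" by blast
  then show ?case by (intro exI[of _ "P + Q"]) (simp add: point_of_in_X)
next
  case (mult f g)
  then obtain P Q where "\<forall>t. f (point_of n m q (\<lambda>v. x v + t * (y v - x v))) = poly P t"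
    "\<forall>t. g (point_of n m q (\<lambda>v. x v + t * (y v - x v))) = poly Q t" by blast
  then show ?case by (intro exI[of _ "P * Q"]) (simp add: point_of_in_X)
qed

text \<open>
  The coordinate ring of an affine space is a domain: along the line through \<open>p\<close> and \<open>p0\<close> both functions
  are polynomials in one variable.
\<close>

lemma regular_X_domain:
  fixes f g :: "'k :: alg_closed_field point \<Rightarrow> 'k"
  assumes f: "f \<in> regular_X n m q" and g: "g \<in> regular_X n m q"
    and fg: "\<And>p. p \<in> X_points n m q \<Longrightarrow> f p * g p = 0"
    and "p0 \<in> X_points n m q" "g p0 \<noteq> 0" and p: "p \<in> X_points n m q"
  shows "f p = 0"
proof -
  obtain x y where xy: "p = point_of n m q x" "p0 = point_of n m q y"
    using p assms(4) X_point_cases by metis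
  obtain P Q where P: "\<forall>t. f (point_of n m q (\<lambda>v. x v + t * (y v - x v))) = poly P t"
    and Q: "\<forall>t. g (point_of n m q (\<lambda>v. x v + t * (y v - x v))) = poly Q t"
    using regular_on_line[OF f] regular_on_line[OF g] by blast
  have "poly (P * Q) t = 0" for t
    using fg[OF point_of_in_X] P Q by (metis poly_mult)
  then have "P * Q = 0" using poly_roots_finite[of "P * Q"] infinite_alg_closed_field by (auto simp: Collect_const)
  moreover have "poly Q 1 \<noteq> 0" using assms(5) Q[rule_format, of 1] xy by simp
  ultimately have "P = 0" by auto
  then show ?thesis using P[rule_format, of 0] xy by simp
qed

text \<open>
  If \<open>P \<circ> \<psi>\<close> is divisible by the pullback of the corner minor \<open>d\<close> in the coordinate ring of \<open>X\<close>,
  then the quotient is itself a pullback. Reduce \<open>P\<close> modulo \<open>d\<close> and the ideal of minors of size \<open>n + 1\<close>, say to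
  \<open>P \<equiv> d g + R\<close>. Then the pullback of \<open>R\<close> is divisible by that of \<open>d\<close>, hence vanishes on the two
  linear subspaces where \<open>d \<circ> \<psi>\<close> obviously does. Each monomial of \<open>R\<close> can be detected on one of
  them, so \<open>R = 0\<close> and \<open>g \<circ> \<psi>\<close> is the quotient.
\<close>

lemma corner_division:
  fixes f :: "'k :: alg_closed_field point \<Rightarrow> 'k"
  assumes nm: "n < m" "n < q" and f: "f \<in> regular_X n m q" and P: "P \<in> regular_M m q"
    and fP: "\<And>p. p \<in> X_points n m q \<Longrightarrow> f p * corner n q (\<psi> n m q p) = P (\<psi> n m q p)"
  shows "\<exists>Q\<in>regular_M m q. \<forall>p\<in>X_points n m q. f p = Q (\<psi> n m q p)"
proof -
  let ?M = "carrier_mat m q :: 'k mat set"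
  let ?I = "determinantal_ideal (n + 1) m q :: ('k mat \<Rightarrow> 'k) set"
  let ?N = "{b \<in> chain_free_exponents n m q. \<not> (\<forall>k<n. b (k, q - n + k) \<noteq> 0)}"
  (* The sum of the determinantal ideal and the principal ideal of the corner minor. *)
  define J where "J = {\<lambda>A\<in>?M. h A + corner n q A * g A | h g. h \<in> ?I \<and> g \<in> regular_M m q}"
  have I: "absorbing m q ?I" by (rule absorbing_ideal[OF determinantal_ideal_ideal])
  have zero: "(\<lambda>A\<in>?M. 0) \<in> ?I" "(\<lambda>A\<in>?M. 0) \<in> regular_M m q"
    using I regular_functions.const unfolding absorbing_def by blast+
  have J: "absorbing m q J"
    unfolding absorbing_def
  proof (intro conjI ballI)
    show "(\<lambda>A\<in>?M. 0) \<in> J" unfolding J_def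
      using zero by (intro CollectI exI[of _ "\<lambda>A\<in>?M. 0"]) (auto intro!: restrict_ext)
    fix a assume "a \<in> J"
    then obtain h g where a: "a = (\<lambda>A\<in>?M. h A + corner n q A * g A)" "h \<in> ?I" "g \<in> regular_M m q"
      unfolding J_def by blast
    show "(\<lambda>A\<in>?M. a A + b A) \<in> J" if bJ: "b \<in> J" for b
    proof -
      obtain h' g' where b: "b = (\<lambda>A\<in>?M. h' A + corner n q A * g' A)" "h' \<in> ?I" "g' \<in> regular_M m q"
        using bJ unfolding J_def by blast
      have "(\<lambda>A\<in>?M. h A + h' A) \<in> ?I"
        using I[unfolded absorbing_def, THEN conjunct2, THEN conjunct1] a(2) b(2) by simp
      moreover have "(\<lambda>A\<in>?M. g A + g' A) \<in> regular_M m q" using a(3) b(3) by (rule regular_functions.add)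
      moreover have "(\<lambda>A\<in>?M. a A + b A)
          = (\<lambda>A\<in>?M. (\<lambda>A\<in>?M. h A + h' A) A + corner n q A * (\<lambda>A\<in>?M. g A + g' A) A)"
        by (intro restrict_ext) (simp add: a(1) b(1) algebra_simps)
      ultimately show ?thesis unfolding J_def by blast
    qed
    show "(\<lambda>A\<in>?M. l A * a A) \<in> J" if l: "l \<in> regular_M m q" for l
    proof -
      have "(\<lambda>A\<in>?M. l A * h A) \<in> ?I"
        using I[unfolded absorbing_def, THEN conjunct2, THEN conjunct2] a(2) l by simp
      moreover have "(\<lambda>A\<in>?M. l A * g A) \<in> regular_M m q" using l a(3) by (rule regular_functions.mult)
      moreover have "(\<lambda>A\<in>?M. l A * a A)
          = (\<lambda>A\<in>?M. (\<lambda>A\<in>?M. l A * h A) A + corner n q A * (\<lambda>A\<in>?M. l A * g A) A)"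
        by (intro restrict_ext) (simp add: a(1) algebra_simps)
      ultimately show ?thesis unfolding J_def by blast
    qed
  qed
  have IJ: "h \<in> J" if h: "h \<in> ?I" for h
  proof -
    have "h \<in> regular_M m q" using ideal.Icarr[OF determinantal_ideal_ideal h] by (simp add: matrix_ring_simps)
    then have "restrict h ?M = h" by (rule regular_restrict)
    moreover have "(\<lambda>A\<in>?M. h A + corner n q A * (\<lambda>A\<in>?M. 0) A) = restrict h ?M" by (intro restrict_ext) simp
    ultimately have "h = (\<lambda>A\<in>?M. h A + corner n q A * (\<lambda>A\<in>?M. 0) A)" by (simp only:)
    then show ?thesis unfolding J_def using h zero(2) by blast
  qed
  have cornerJ: "restrict (corner n q) ?M \<in> J"
  proof -
    have "restrict (corner n q) ?M = (\<lambda>A\<in>?M. (\<lambda>A\<in>?M. 0) A + corner n q A * (\<lambda>A\<in>?M. 1) A)"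
      by (intro restrict_ext) simp
    then show ?thesis unfolding J_def using zero(1) regular_functions.const by blast
  qed
  have "reducible_to m q ?N J P"
  proof (rule reduction[OF J P])
    fix b assume b: "b \<in> exponents m q - ?N"
    show "\<exists>r x y. (\<forall>t<r. \<forall>s<t. x s < x t \<and> y s < y t) \<and> (\<forall>t<r. b (x t, y t) \<noteq> 0) \<and>
      (\<lambda>A\<in>?M. minor_at r x y A) \<in> J"
    proof (cases "b \<in> chain_free_exponents n m q")
      case True
      then have "\<forall>k<n. b (k, q - n + k) \<noteq> 0" using b by blast
      moreover have "(\<lambda>A\<in>?M. minor_at n (\<lambda>t. t) (\<lambda>t. q - n + t) A) \<in> J"
        using cornerJ unfolding corner_def .
      ultimately show ?thesis
        by (intro exI[of _ n] exI[of _ "\<lambda>t. t"] exI[of _ "\<lambda>t. q - n + t"]) auto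
    next
      case False
      then show ?thesis using chain_gives_minor[of b m q n, where 'k = 'k] b IJ by blast
    qed
  qed
  then obtain B c h' where B: "finite B" "B \<subseteq> ?N" and "h' \<in> J"
    and PB: "\<And>A. A \<in> ?M \<Longrightarrow> P A = (\<Sum>b\<in>B. c b * monomial m q b A) + h' A"
    unfolding reducible_to_def by blast
  from \<open>h' \<in> J\<close> obtain h g where hg: "h' = (\<lambda>A\<in>?M. h A + corner n q A * g A)" "h \<in> ?I" "g \<in> regular_M m q"
    unfolding J_def by blast
  define rest where "rest p = f p - g (\<psi> n m q p)" for p :: "'k point"
  have main: "(\<Sum>b\<in>B. c b * monomial m q b (\<psi> n m q p)) = rest p * corner n q (\<psi> n m q p)"
    if p: "p \<in> X_points n m q" for p
    using fP[OF p] PB[OF \<psi>_carrier[OF p]] determinantal_ideal_vanishes[OF hg(2) p] \<psi>_carrier[OF p]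
    by (simp add: hg(1) rest_def algebra_simps)
  have "c b = 0" if "b \<in> B" for b
  proof (cases "n = 0")
    case True
    (* The corner minor is 1, its diagonal is empty, and no exponent remains after the reduction. *)
    then show ?thesis using B(2) that by auto
  next
    case n0: False
    let ?Y1 = "Inl ` ({..<n} \<times> {n - 1}) :: (nat \<times> nat + nat \<times> nat) set"
    let ?Y2 = "Inr ` ({q - n..<q} \<times> {n - 1}) :: (nat \<times> nat + nat \<times> nat) set"
    show ?thesis
    proof (rule normal_form_unique[where \<Y> = "{?Y1, ?Y2}" and n = n, OF B(1) _ _ _ that])
      show "B \<subseteq> exponents m q" using B(2) by (auto simp: chain_free_exponents_def)
      fix a assume "a \<in> B"
      then have a: "a \<in> ?N" using B(2) by blast
      let ?S = "{p. a p \<noteq> 0}"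
      have "?S \<subseteq> {..<m} \<times> {..<q}"
      proof
        have "a \<in> exponents m q" using a by (simp add: chain_free_exponents_def)
        then have supp: "\<forall>p. p \<notin> {..<m} \<times> {..<q} \<longrightarrow> a p = 0"
          unfolding exponents_def mem_Collect_eq .
        fix p assume "p \<in> ?S"
        then show "p \<in> {..<m} \<times> {..<q}" using supp by (metis mem_Collect_eq)
      qed
      moreover have "\<nexists>p. chain_at below ?S n p" using a by (simp add: chain_free_exponents_def)
      moreover have "\<not> (\<forall>k<n. (k, q - n + k) \<in> ?S)" using a by simp
      ultimately obtain l where l: "\<forall>p\<in>?S. l p < n" "\<forall>p\<in>?S. \<forall>p'\<in>?S. below p p' \<longrightarrow> l p \<noteq> l p'"
        and c: "(\<forall>p\<in>?S. fst p < n \<longrightarrow> l p \<noteq> n - 1) \<or> (\<forall>p\<in>?S. q - n \<le> snd p \<longrightarrow> l p \<noteq> n - 1)"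
        using level_decomposition[of ?S m q n] nm(2) by blast
      define Y where "Y = (if \<forall>p\<in>?S. fst p < n \<longrightarrow> l p \<noteq> n - 1 then ?Y1 else ?Y2)"
      have "\<forall>p k. a p \<noteq> 0 \<longrightarrow> Inl (fst p, k) \<in> Y \<or> Inr (snd p, k) \<in> Y \<longrightarrow> l p \<noteq> k"
        using c by (cases "\<forall>p\<in>?S. fst p < n \<longrightarrow> l p \<noteq> n - 1") (auto simp: Y_def)
      moreover have "Y \<in> {?Y1, ?Y2}" unfolding Y_def by simp
      ultimately show "\<exists>l. \<exists>Y\<in>{?Y1, ?Y2}. (\<forall>p. a p \<noteq> 0 \<longrightarrow> l p < n) \<and>
        (\<forall>p p'. a p \<noteq> 0 \<longrightarrow> a p' \<noteq> 0 \<longrightarrow> below p p' \<longrightarrow> l p \<noteq> l p') \<and>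
        (\<forall>p k. a p \<noteq> 0 \<longrightarrow> Inl (fst p, k) \<in> Y \<or> Inr (snd p, k) \<in> Y \<longrightarrow> l p \<noteq> k)"
        using l by (intro exI[of _ l] bexI[of _ Y]) simp_all
    next
      fix Y and x :: "nat \<times> nat + nat \<times> nat \<Rightarrow> 'k"
      assume Y: "Y \<in> {?Y1, ?Y2}" and x0: "\<forall>v\<in>Y. x v = 0"
      have "(\<forall>i<n. x (Inl (i, n - 1)) = 0) \<or> (\<forall>t<n. x (Inr (q - n + t, n - 1)) = 0)"
      proof (cases "Y = ?Y1")
        case True
        then show ?thesis using x0 by auto
      next
        case False
        then have "Y = ?Y2" using Y by blast
        moreover have "(q - n + t, n - 1) \<in> {q - n..<q} \<times> {n - 1}" if "t < n" for t
          using that nm(2) by (simp, arith)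
        ultimately have "Inr (q - n + t, n - 1) \<in> Y" if "t < n" for t using that by blast
        then show ?thesis using x0 by blast
      qed
      then have "corner n q (\<psi> n m q (point_of n m q x)) = 0"
        using n0 nm by (intro corner_vanishes) auto
      then show "(\<Sum>b\<in>B. c b * monomial m q b (\<psi> n m q (point_of n m q x))) = 0"
        using main[OF point_of_in_X] by simp
    qed
  qed
  then have zero_prod: "rest p * corner n q (\<psi> n m q p) = 0" if "p \<in> X_points n m q" for p
    using main[OF that] by simp
  have gX: "pullback (X_points n m q) (\<psi> n m q) g \<in> regular_X n m q" by (rule \<psi>_pullback_regular[OF hg(3)])
  have "(\<lambda>p\<in>X_points n m q. f p + (\<lambda>p\<in>X_points n m q. (\<lambda>p\<in>X_points n m q. - 1) p * pullback (X_points n m q) (\<psi> n m q) g p) p) \<in> regular_X n m q"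
    using f gX unfolding regular_X_def by (intro regular_functions.add regular_functions.mult regular_functions.const)
  moreover have "(\<lambda>p\<in>X_points n m q. f p + (\<lambda>p\<in>X_points n m q. (\<lambda>p\<in>X_points n m q. - 1) p * pullback (X_points n m q) (\<psi> n m q) g p) p)
     = restrict rest (X_points n m q)"
    by (intro restrict_ext) (simp add: rest_def pullback_def)
  ultimately have restX: "restrict rest (X_points n m q) \<in> regular_X n m q" by simp
  have cX: "pullback (X_points n m q) (\<psi> n m q) (restrict (corner n q) ?M) \<in> regular_X n m q"
    using nm by (intro \<psi>_pullback_regular corner_regular) auto
  obtain x where x: "corner n q (\<psi> n m q (point_of n m q x)) = (1 :: 'k)"
    using corner_nonzero[of n m q] nm by auto
  have c: "pullback (X_points n m q) (\<psi> n m q) (restrict (corner n q) ?M) p = corner n q (\<psi> n m q p)"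
    if "p \<in> X_points n m q" for p
    using that \<psi>_carrier[OF that] by (simp add: pullback_def)
  have "restrict rest (X_points n m q) p = 0" if p: "p \<in> X_points n m q" for p
  proof (rule regular_X_domain[OF restX cX _ point_of_in_X[of n m q x] _ p])
    fix p' :: "'k point" assume "p' \<in> X_points n m q"
    then show "restrict rest (X_points n m q) p' *
        pullback (X_points n m q) (\<psi> n m q) (restrict (corner n q) ?M) p' = 0"
      using zero_prod[of p'] by (simp only: c restrict_apply' if_True)
  qed (simp only: c[OF point_of_in_X] x, simp)
  then show ?thesis using hg(3) by (auto simp: rest_def)
qed

lemma corner_power_division:
  fixes f :: "'k :: alg_closed_field point \<Rightarrow> 'k"
  assumes nm: "n < m" "n < q" and "f \<in> regular_X n m q" and "P \<in> regular_M m q"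
    and "\<And>p. p \<in> X_points n m q \<Longrightarrow> f p * corner n q (\<psi> n m q p) ^ N = P (\<psi> n m q p)"
  shows "\<exists>Q\<in>regular_M m q. \<forall>p\<in>X_points n m q. f p = Q (\<psi> n m q p)"
  using assms(3-)
proof (induction N arbitrary: P)
  case 0
  then show ?case by auto
next
  case (Suc N)
  let ?X = "X_points n m q :: 'k point set"
  let ?c = "pullback ?X (\<psi> n m q) (restrict (corner n q) (carrier_mat m q)) :: 'k point \<Rightarrow> 'k"
  let ?f = "\<lambda>p\<in>?X. f p * (\<lambda>p\<in>?X. ?c p ^ N) p"
  have c: "?c p = corner n q (\<psi> n m q p)" if "p \<in> ?X" for p
    using that \<psi>_carrier[OF that] by (simp add: pullback_def)
  have "?c \<in> regular_X n m q" using nm by (intro \<psi>_pullback_regular corner_regular) auto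
  then have "(\<lambda>p\<in>?X. ?c p ^ N) \<in> regular_X n m q"
    unfolding regular_X_def by (intro regular_power restrict_regular)
  then have "?f \<in> regular_X n m q"
    using Suc.prems(1) unfolding regular_X_def by (intro regular_functions.mult)
  moreover have "?f p * corner n q (\<psi> n m q p) = P (\<psi> n m q p)" if "p \<in> ?X" for p
    using Suc.prems(3)[OF that] that c[OF that] by (simp add: mult_ac)
  ultimately obtain Q where Q: "Q \<in> regular_M m q" "\<forall>p\<in>?X. ?f p = Q (\<psi> n m q p)"
    using corner_division[OF nm _ Suc.prems(2)] by blast
  show ?case
  proof (rule Suc.IH[OF Suc.prems(1) Q(1)])
    fix p assume "p \<in> ?X"
    then show "f p * corner n q (\<psi> n m q p) ^ N = Q (\<psi> n m q p)" using Q(2) c by simp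
  qed
qed

section \<open>Invariant functions\<close>

lemma GL_inverse:
  fixes g :: "'k :: field mat"
  assumes "g \<in> carrier (GL TYPE('k) n)"
  shows "g \<in> carrier_mat n n" "inv\<^bsub>GL TYPE('k) n\<^esub> g \<in> carrier_mat n n"
    "g * inv\<^bsub>GL TYPE('k) n\<^esub> g = 1\<^sub>m n" "inv\<^bsub>GL TYPE('k) n\<^esub> g * g = 1\<^sub>m n"
proof -
  interpret R: Ring.ring "ring_mat TYPE('k) n ()" by (rule ring_mat)
  have g: "g \<in> Units (ring_mat TYPE('k) n ())" using assms by (simp add: GL_def units_of_carrier)
  have inv: "inv\<^bsub>GL TYPE('k) n\<^esub> g = inv\<^bsub>ring_mat TYPE('k) n ()\<^esub> g"
    unfolding GL_def by (rule R.units_of_inv[OF g])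
  show "g \<in> carrier_mat n n" using R.Units_closed[OF g] by (simp add: ring_mat_simps)
  show "inv\<^bsub>GL TYPE('k) n\<^esub> g \<in> carrier_mat n n"
    unfolding inv using R.Units_inv_closed[OF g] by (simp add: ring_mat_simps)
  show "g * inv\<^bsub>GL TYPE('k) n\<^esub> g = 1\<^sub>m n" "inv\<^bsub>GL TYPE('k) n\<^esub> g * g = 1\<^sub>m n"
    unfolding inv using R.Units_r_inv[OF g] R.Units_l_inv[OF g] by (simp_all add: ring_mat_simps)
qed

lemma GL_act_X:
  fixes g :: "'k :: field mat"
  assumes g: "g \<in> carrier (GL TYPE('k) n)" and p: "p \<in> X_points n m q"
  shows "GL_act n m q g p \<in> X_points n m q"
proof -
  obtain u \<xi> where p': "p = (u, \<xi>)" "\<And>i. i < m \<Longrightarrow> u i \<in> carrier_vec n" "\<And>j. j < q \<Longrightarrow> \<xi> j \<in> dual_space n"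
    using p by (auto simp: X_points_def)
  let ?h = "inv\<^bsub>GL TYPE('k) n\<^esub> g"
  note gl = GL_inverse[OF g]
  have "(\<lambda>v\<in>carrier_vec n. \<xi> j (?h *\<^sub>v v)) \<in> dual_space n" if "j < q" for j
    using p'(3)[OF that] gl(2)
    by (auto simp: dual_space_def mult_add_distrib_mat_vec[OF gl(2)] mult_mat_vec[OF gl(2)])
  then show ?thesis using p'(2) gl(1) by (auto simp: p'(1) GL_act_def X_points_def)
qed

lemma \<psi>_invariant:
  fixes g :: "'k :: field mat"
  assumes g: "g \<in> carrier (GL TYPE('k) n)" and p: "p \<in> X_points n m q"
  shows "\<psi> n m q (GL_act n m q g p) = \<psi> n m q p"
proof -
  obtain u \<xi> where p': "p = (u, \<xi>)" "\<And>i. i < m \<Longrightarrow> u i \<in> carrier_vec n"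
    using p by (auto simp: X_points_def)
  let ?h = "inv\<^bsub>GL TYPE('k) n\<^esub> g"
  note gl = GL_inverse[OF g]
  have "?h *\<^sub>v (g *\<^sub>v u i) = u i" if "i < m" for i
    using assoc_mult_mat_vec[OF gl(2,1) p'(2)[OF that], symmetric] gl(4) p'(2)[OF that] by simp
  then show ?thesis using GL_act_X[OF g p] p p'(2) gl(1)
    unfolding \<psi>_def p'(1) GL_act_def by (auto intro!: eq_matI)
qed

text \<open>
  For invertible \<open>U\<close> and \<open>X\<close> the inverse of \<open>X\<close> is \<open>(U X)\<inverse> U\<close>; replacing \<open>(U X)\<inverse>\<close> by the adjugate of
  \<open>U X\<close> multiplies it by \<open>det (U X)\<close>.
\<close>

lemma adjugate_between_factors:
  fixes U X :: "'k :: field mat"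
  assumes U: "U \<in> carrier_mat n n" and X: "X \<in> carrier_mat n n" and d: "det (U * X) \<noteq> 0"
  shows "X * adj_mat (U * X) * U = det (U * X) \<cdot>\<^sub>m 1\<^sub>m n"
proof -
  let ?N = "U * X"
  have N: "?N \<in> carrier_mat n n" using U X by simp
  note adj = adj_mat[OF N]
  have "det U \<noteq> 0" using d by (simp add: det_mult[OF U X])
  then have "U \<in> Units (ring_mat TYPE('k) n ())" by (rule det_non_zero_imp_unit[OF U])
  then obtain V where V: "V \<in> carrier_mat n n" "V * U = 1\<^sub>m n"
    unfolding Units_def by (auto simp: ring_mat_simps)
  let ?W = "X * adj_mat ?N * U"
  have W: "?W \<in> carrier_mat n n" using U X adj(1) by auto
  have "U * ?W = ?N * adj_mat ?N * U"
    using assoc_mult_mat[OF U mult_carrier_mat[OF X adj(1)] U] assoc_mult_mat[OF U X adj(1)] by simp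
  also have "\<dots> = det ?N \<cdot>\<^sub>m U"
    unfolding adj(2) using mult_smult_assoc_mat[OF one_carrier_mat U, of "det ?N"] U by simp
  finally have "V * (U * ?W) = V * (det ?N \<cdot>\<^sub>m U)" by simp
  also have "\<dots> = det ?N \<cdot>\<^sub>m 1\<^sub>m n" using mult_smult_distrib[OF V(1) U, of "det ?N"] V(2) by simp
  also have "V * (U * ?W) = V * U * ?W" by (rule assoc_mult_mat[OF V(1) U W, symmetric])
  also have "\<dots> = ?W" unfolding V(2) by (rule left_mult_one_mat[OF W])
  finally show ?thesis .
qed

text \<open>
  For \<open>A\<close> in the image of \<open>\<psi>\<close> with nonvanishing corner minor, this is the point over \<open>A\<close> whose last \<open>n\<close>
  functionals are the standard coordinates. Its vectors must then be the last \<open>n\<close> entries of the rows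
  of \<open>A\<close>, and its functionals solve a linear system with the corner submatrix, which gives Cramer's
  formula.
\<close>

definition slice :: "nat \<Rightarrow> nat \<Rightarrow> nat \<Rightarrow> 'k :: field mat \<Rightarrow> 'k point" where
  "slice n m q A = point_of n m q (case_sum (\<lambda>(i, k). A $$ (i, q - n + k))
     (\<lambda>(j, k). inverse (corner n q A) *
        (\<Sum>l<n. adj_mat (mat n n (\<lambda>(s, t). A $$ (s, q - n + t))) $$ (k, l) * A $$ (l, j))))"

lemma slice_in_X: "slice n m q A \<in> X_points n m q"
  unfolding slice_def by (rule point_of_in_X)

lemma slice_regular:
  fixes f :: "'k :: field point \<Rightarrow> 'k"
  assumes nm: "n < m" "n < q" and f: "f \<in> regular_X n m q"
  shows "\<exists>N. \<exists>P\<in>regular_M m q. \<forall>A\<in>carrier_mat m q. corner n q A \<noteq> 0 \<longrightarrow> f (slice n m q A) * corner n q A ^ N = P A"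
  using f unfolding regular_X_def
proof (induction rule: regular_functions.induct)
  case (const c)
  show ?case
    by (rule exI[of _ 0], rule bexI[of _ "\<lambda>A\<in>carrier_mat m q. c"])
      (auto simp: slice_def point_of_in_X intro: regular_functions.const)
next
  case (coord f)
  consider i k where "f = (\<lambda>(u, \<xi>). u i $ k)" "i < m" "k < n"
    | j k where "f = (\<lambda>(u, \<xi>). \<xi> j (unit_vec n k))" "j < q" "k < n"
    using coord unfolding X_coordinates_def by blast
  then show ?case
  proof cases
    case (1 i k)
    show ?thesis
    proof (rule exI[of _ 0], rule bexI)
      show "(\<lambda>A\<in>carrier_mat m q. A $$ (i, q - n + k)) \<in> regular_M m q"
        using 1 nm by (intro regular_entry) auto
    qed (use 1 in \<open>auto simp: slice_def point_of_in_X case_prod_beta point_of_coordinates\<close>)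
  next
    case (2 j k)
    let ?adj = "\<lambda>l A. adj_mat (mat n n (\<lambda>(s, t). A $$ (s, q - n + t))) $$ (k, l) :: 'k"
    have adj: "restrict (?adj l) (carrier_mat m q) \<in> regular_M m q" if l: "l < n" for l
    proof -
      let ?x = "\<lambda>s. if s < l then s else Suc s" and ?y = "\<lambda>t. q - n + (if t < k then t else Suc t)"
      have "restrict (?adj l) (carrier_mat m q)
          = (\<lambda>A\<in>carrier_mat m q. (\<lambda>A\<in>carrier_mat m q. (- 1) ^ (l + k)) A * restrict (minor_at (n - 1) ?x ?y) (carrier_mat m q) A)"
      proof (rule restrict_ext)
        fix A :: "'k mat" assume "A \<in> carrier_mat m q"
        moreover have "mat_delete (mat n n (\<lambda>(s, t). A $$ (s, q - n + t))) l k
            = mat (n - 1) (n - 1) (\<lambda>(s, t). A $$ (?x s, ?y t))"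
          unfolding mat_delete_def using l 2(3) by (intro eq_matI) auto
        ultimately show "?adj l A = (\<lambda>A\<in>carrier_mat m q. (- 1) ^ (l + k)) A * restrict (minor_at (n - 1) ?x ?y) (carrier_mat m q) A"
          using l 2(3) by (simp add: adj_mat_def cofactor_def)
      qed
      also have "\<dots> \<in> regular_M m q"
        using l 2(3) nm by (intro regular_functions.mult regular_functions.const regular_minor_at) auto
      finally show ?thesis .
    qed
    show ?thesis
    proof (rule exI[of _ 1], rule bexI)
      show "(\<lambda>A\<in>carrier_mat m q. \<Sum>l<n. ?adj l A * A $$ (l, j)) \<in> regular_M m q"
        using adj 2(2) nm by (intro regular_sum regular_mult regular_entry) auto
    qed (use 2 in \<open>auto simp: slice_def point_of_in_X case_prod_beta point_of_coordinates\<close>)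
  qed
next
  case (add f g)
  then obtain N P N' P' where P: "P \<in> regular_M m q" "P' \<in> regular_M m q"
    and e: "\<forall>A\<in>carrier_mat m q. corner n q A \<noteq> 0 \<longrightarrow> f (slice n m q A) * corner n q A ^ N = P A"
      "\<forall>A\<in>carrier_mat m q. corner n q A \<noteq> 0 \<longrightarrow> g (slice n m q A) * corner n q A ^ N' = P' A" by blast
  have c: "restrict (corner n q) (carrier_mat m q :: 'k mat set) \<in> regular_M m q"
    using nm by (intro corner_regular) auto
  show ?case
  proof (rule exI[of _ "N + N'"], rule bexI)
    show "(\<lambda>A\<in>carrier_mat m q. P A * corner n q A ^ N' + P' A * corner n q A ^ N) \<in> regular_M m q"
      by (intro regular_add regular_mult regular_power c restrict_regular[OF P(1)] restrict_regular[OF P(2)])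
    show "\<forall>A\<in>carrier_mat m q. corner n q A \<noteq> 0 \<longrightarrow>
      (\<lambda>x\<in>X_points n m q. f x + g x) (slice n m q A) * corner n q A ^ (N + N')
        = (\<lambda>A\<in>carrier_mat m q. P A * corner n q A ^ N' + P' A * corner n q A ^ N) A"
    proof (intro ballI impI)
      fix A :: "'k mat" assume A: "A \<in> carrier_mat m q" "corner n q A \<noteq> 0"
      let ?s = "slice n m q A" and ?c = "corner n q A"
      have "(f ?s + g ?s) * ?c ^ (N + N') = f ?s * ?c ^ N * ?c ^ N' + g ?s * ?c ^ N' * ?c ^ N"
        by (simp add: power_add algebra_simps)
      then show "(\<lambda>x\<in>X_points n m q. f x + g x) ?s * ?c ^ (N + N')
          = (\<lambda>A\<in>carrier_mat m q. P A * corner n q A ^ N' + P' A * corner n q A ^ N) A"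
        using e A by (simp add: slice_in_X)
    qed
  qed
next
  case (mult f g)
  then obtain N P N' P' where P: "P \<in> regular_M m q" "P' \<in> regular_M m q"
    and e: "\<forall>A\<in>carrier_mat m q. corner n q A \<noteq> 0 \<longrightarrow> f (slice n m q A) * corner n q A ^ N = P A"
      "\<forall>A\<in>carrier_mat m q. corner n q A \<noteq> 0 \<longrightarrow> g (slice n m q A) * corner n q A ^ N' = P' A" by blast
  show ?case
  proof (rule exI[of _ "N + N'"], rule bexI)
    show "(\<lambda>A\<in>carrier_mat m q. P A * P' A) \<in> regular_M m q" using P by (rule regular_functions.mult)
    show "\<forall>A\<in>carrier_mat m q. corner n q A \<noteq> 0 \<longrightarrow>
      (\<lambda>x\<in>X_points n m q. f x * g x) (slice n m q A) * corner n q A ^ (N + N')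
        = (\<lambda>A\<in>carrier_mat m q. P A * P' A) A"
    proof (intro ballI impI)
      fix A :: "'k mat" assume A: "A \<in> carrier_mat m q" "corner n q A \<noteq> 0"
      let ?s = "slice n m q A" and ?c = "corner n q A"
      have "(f ?s * g ?s) * ?c ^ (N + N') = (f ?s * ?c ^ N) * (g ?s * ?c ^ N')"
        by (simp add: power_add mult_ac)
      then show "(\<lambda>x\<in>X_points n m q. f x * g x) ?s * ?c ^ (N + N') = (\<lambda>A\<in>carrier_mat m q. P A * P' A) A"
        using e A by (simp add: slice_in_X)
    qed
  qed
qed

text \<open>
  The group element is the matrix whose rows are the last \<open>n\<close> functionals: applied to a vector it
  returns the values of these functionals, which are entries of \<open>\<psi> n m q p\<close>.
\<close>

lemma slice_in_orbit:
  fixes p :: "'k :: field point"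
  assumes nm: "n < m" "n < q" and p: "p \<in> X_points n m q" and c: "corner n q (\<psi> n m q p) \<noteq> 0"
  shows "\<exists>g\<in>carrier (GL TYPE('k) n). slice n m q (\<psi> n m q p) = GL_act n m q g p"
proof -
  obtain x where x: "p = point_of n m q x" using p by (rule X_point_cases)
  let ?A = "\<psi> n m q p"
  let ?U = "mat n n (\<lambda>(i, k). x (Inl (i, k)))" and ?X = "mat n n (\<lambda>(k, t). x (Inr (q - n + t, k)))"
  let ?N = "mat n n (\<lambda>(s, t). ?A $$ (s, q - n + t))"
  let ?g = "transpose_mat ?X"
  have N: "?N = ?U * ?X" unfolding x using nm by (intro corner_\<psi>) auto
  have d: "corner n q ?A = det (?U * ?X)" unfolding corner_def N ..
  have Xd: "det ?X \<noteq> 0" using c unfolding d by (simp add: det_mult[of _ n])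
  have "?g \<in> Units (ring_mat TYPE('k) n ())"
    by (rule det_non_zero_imp_unit) (use Xd in \<open>auto simp: det_transpose[of _ n]\<close>)
  then have g: "?g \<in> carrier (GL TYPE('k) n)" by (simp add: GL_def units_of_carrier)
  let ?h = "inv\<^bsub>GL TYPE('k) n\<^esub> ?g"
  note gl = GL_inverse[OF g]
  note W = adjugate_between_factors[of ?U n ?X, OF _ _ c[unfolded d], simplified]
  have adjc: "adj_mat ?N \<in> carrier_mat n n" by (rule adj_mat(1)) simp
  have first: "vec n (\<lambda>k. ?A $$ (i, q - n + k)) = ?g *\<^sub>v vec n (\<lambda>k. x (Inl (i, k)))" if "i < m" for i
    using that nm by (intro eq_vecI) (auto simp: x \<psi>_point_of scalar_prod_def lessThan_atLeast0 mult.commute intro!: sum.cong)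
  have second: "(\<Sum>k<n. inverse (corner n q ?A) * (\<Sum>l<n. adj_mat ?N $$ (k, l) * ?A $$ (l, j)) * v $ k)
      = (\<Sum>k<n. x (Inr (j, k)) * (?h *\<^sub>v v) $ k)" if j: "j < q" and v: "v \<in> carrier_vec n" for j v
  proof -
    let ?\<xi> = "vec n (\<lambda>k. x (Inr (j, k)))"
    let ?y = "adj_mat ?N *\<^sub>v (?U *\<^sub>v ?\<xi>)"
    have Uc: "?U \<in> carrier_mat n n" and Xc: "?X \<in> carrier_mat n n" and \<xi>c: "?\<xi> \<in> carrier_vec n" by auto
    have "?U *\<^sub>v ?\<xi> = vec n (\<lambda>l. ?A $$ (l, j))"
      using j nm by (intro eq_vecI) (auto simp: x \<psi>_point_of scalar_prod_def lessThan_atLeast0)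
    then have y: "?y $ k = (\<Sum>l<n. adj_mat ?N $$ (k, l) * ?A $$ (l, j))" if "k < n" for k
      using that adjc by (simp add: scalar_prod_def lessThan_atLeast0)
    have yc: "?y \<in> carrier_vec n" using adjc by (auto intro!: mult_mat_vec_carrier)
    have "?X *\<^sub>v ?y = (?X * adj_mat ?N * ?U) *\<^sub>v ?\<xi>"
      using assoc_mult_mat_vec[OF mult_carrier_mat[OF Xc adjc] Uc \<xi>c]
        assoc_mult_mat_vec[OF Xc adjc mult_mat_vec_carrier[OF Uc \<xi>c]] by simp
    also have "\<dots> = corner n q ?A \<cdot>\<^sub>v ?\<xi>"
      unfolding N d W by (intro eq_vecI) (auto simp: scalar_prod_def if_distrib[where f = "\<lambda>a. _ * a"]
        if_distrib[where f = "\<lambda>a. a * _"] cong: if_cong)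
    finally have Xy: "?X *\<^sub>v ?y = corner n q ?A \<cdot>\<^sub>v ?\<xi>" .
    define w where "w = ?h *\<^sub>v v"
    have w: "w \<in> carrier_vec n" using gl(2) v by (auto simp: w_def intro!: mult_mat_vec_carrier)
    have vw: "v = ?g *\<^sub>v w"
      unfolding w_def using assoc_mult_mat_vec[OF gl(1,2) v] gl(3) v by simp
    have "?y \<bullet> v = (?X *\<^sub>v ?y) \<bullet> w"
      unfolding vw using transpose_vec_mult_scalar[of ?g n n w ?y] yc w by simp
    then have "?y \<bullet> v = corner n q ?A * (?\<xi> \<bullet> w)" unfolding Xy using w by simp
    then have "inverse (corner n q ?A) * (?y \<bullet> v) = ?\<xi> \<bullet> w" using c by simp
    moreover have "inverse (corner n q ?A) * (?y \<bullet> v)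
        = (\<Sum>k<n. inverse (corner n q ?A) * (\<Sum>l<n. adj_mat ?N $$ (k, l) * ?A $$ (l, j)) * v $ k)"
    proof -
      have "inverse (corner n q ?A) * (?y \<bullet> v) = (\<Sum>k<n. inverse (corner n q ?A) * ?y $ k * v $ k)"
        using v unfolding scalar_prod_def by (simp only: carrier_vecD sum_distrib_left lessThan_atLeast0 mult.assoc)
      also have "\<dots> = (\<Sum>k<n. inverse (corner n q ?A) * (\<Sum>l<n. adj_mat ?N $$ (k, l) * ?A $$ (l, j)) * v $ k)"
        by (intro sum.cong refl) (simp only: y lessThan_iff)
      finally show ?thesis .
    qed
    moreover have "?\<xi> \<bullet> w = (\<Sum>k<n. x (Inr (j, k)) * w $ k)"
      using w by (simp add: scalar_prod_def lessThan_atLeast0)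
    ultimately show ?thesis by (simp add: w_def)
  qed
  have "slice n m q ?A = GL_act n m q ?g p"
  proof -
    have hv: "?h *\<^sub>v v \<in> carrier_vec n" if "v \<in> carrier_vec n" for v
      using gl(2) that by (rule mult_mat_vec_carrier)
    have "(\<lambda>i\<in>{..<m}. vec n (\<lambda>k. ?A $$ (i, q - n + k)))
        = (\<lambda>i\<in>{..<m}. ?g *\<^sub>v (\<lambda>i\<in>{..<m}. vec n (\<lambda>k. x (Inl (i, k)))) i)"
      by (intro restrict_ext) (simp add: first)
    moreover have "(\<lambda>j\<in>{..<q}. \<lambda>v\<in>carrier_vec n. \<Sum>k<n. inverse (corner n q ?A) * (\<Sum>l<n. adj_mat ?N $$ (k, l) * ?A $$ (l, j)) * v $ k)
        = (\<lambda>j\<in>{..<q}. \<lambda>v\<in>carrier_vec n. (\<lambda>j\<in>{..<q}. \<lambda>v\<in>carrier_vec n. \<Sum>k<n. x (Inr (j, k)) * v $ k) j (?h *\<^sub>v v))"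
      by (intro restrict_ext) (simp add: second hv)
    ultimately show ?thesis
      unfolding slice_def GL_act_def by (subst (5) x) (simp add: point_of_def)
  qed
  then show ?thesis using g by blast
qed

text \<open>
  An invariant has the same value at \<open>p\<close> and at the representative \<open>slice n m q (\<psi> n m q p)\<close> of its
  orbit, which is a rational function of \<open>\<psi> n m q p\<close> with a power of the corner minor as denominator. One more
  factor makes the equation true also where the corner minor vanishes, and then the factors are
  divided out.
\<close>

theorem first_fundamental_theorem:
  fixes f :: "'k :: alg_closed_field point \<Rightarrow> 'k"
  assumes nm: "n < m" "n < q" and f: "f \<in> regular_X n m q"
    and inv: "invariant_map (carrier (GL TYPE('k) n)) (GL_act n m q) (X_points n m q) f"
  shows "\<exists>Q\<in>regular_M m q. \<forall>p\<in>X_points n m q. f p = Q (\<psi> n m q p)"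
proof -
  obtain N P where P: "P \<in> regular_M m q"
    and e: "\<And>A. A \<in> carrier_mat m q \<Longrightarrow> corner n q A \<noteq> 0 \<Longrightarrow> f (slice n m q A) * corner n q A ^ N = P A"
    using slice_regular[OF nm f] by blast
  have c: "restrict (corner n q) (carrier_mat m q :: 'k mat set) \<in> regular_M m q"
    using nm by (intro corner_regular) auto
  show ?thesis
  proof (rule corner_power_division[OF nm f])
    show "(\<lambda>A\<in>carrier_mat m q. P A * corner n q A) \<in> regular_M m q"
      by (intro regular_mult c restrict_regular[OF P])
    fix p :: "'k point" assume p: "p \<in> X_points n m q"
    show "f p * corner n q (\<psi> n m q p) ^ Suc N = (\<lambda>A\<in>carrier_mat m q. P A * corner n q A) (\<psi> n m q p)"
    proof (cases "corner n q (\<psi> n m q p) = 0")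
      case True
      then show ?thesis using \<psi>_carrier[OF p] by simp
    next
      case False
      then have "f p = f (slice n m q (\<psi> n m q p))"
        using slice_in_orbit[OF nm p] inv p unfolding invariant_map_def by metis
      then show ?thesis using e[OF \<psi>_carrier[OF p] False] \<psi>_carrier[OF p] by (simp add: mult_ac)
    qed
  qed
qed

section \<open>The quotient map\<close>

text \<open>
  Take a nonvanishing minor of maximal size \<open>r \<le> n\<close>, with columns \<open>y 0, \<dots>, y (r - 1)\<close>. Bordering it
  with row \<open>i\<close> and column \<open>j\<close> gives a singular matrix, and expanding its determinant along the new row
  expresses the entry at \<open>(i, j)\<close> through the entries of row \<open>i\<close> in these columns, with coefficients
  independent of \<open>i\<close>. This is a factorisation through dimension \<open>r\<close>.
\<close>

lemma \<psi>_onto_determinantal_variety: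
  fixes A :: "'k :: field mat"
  assumes A: "A \<in> determinantal_variety (n + 1) m q"
  obtains p where "p \<in> X_points n m q" "\<psi> n m q p = A"
proof -
  have AM: "A \<in> carrier_mat m q" and van: "\<And>f. f \<in> determinantal_ideal (n + 1) m q \<Longrightarrow> f A = 0"
    using A by (auto simp: determinantal_variety_def)
  define nz where "nz r \<longleftrightarrow> (\<exists>x y. (\<forall>t<r. x t < m \<and> y t < q) \<and> minor_at r x y A \<noteq> 0)" for r
  have "nz 0" by (auto simp: nz_def)
  define r where "r = (GREATEST r. r \<le> n \<and> nz r)"
  have r: "r \<le> n \<and> nz r" unfolding r_def
    by (rule GreatestI_nat[where k = 0 and b = n]) (use \<open>nz 0\<close> in auto)
  have "\<not> nz (Suc r)"
  proof
    assume s: "nz (Suc r)"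
    show False
    proof (cases "r < n")
      case True
      then have "Suc r \<le> r" unfolding r_def by (intro Greatest_le_nat[where b = n]) (use s r in \<open>auto simp: r_def\<close>)
      then show False by simp
    next
      case False
      then have rn: "Suc r = n + 1" using r by simp
      obtain x y where xy: "\<forall>t<n + 1. x t < m \<and> y t < q" "minor_at (n + 1) x y A \<noteq> 0"
        using s unfolding nz_def rn by blast
      have "restrict (minor_at (n + 1) x y) (carrier_mat m q) \<in> (determinantal_ideal (n + 1) m q :: ('k mat \<Rightarrow> 'k) set)"
        using xy(1) by (intro minor_at_in_determinantal_ideal) auto
      from van[OF this] show False using AM xy(2) by simp
    qed
  qed
  obtain x y where xy: "\<forall>t<r. x t < m \<and> y t < q" "minor_at r x y A \<noteq> 0" using r unfolding nz_def by blast
  (* The cofactors along the last row of the bordered matrix, which do not involve that row. *)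
  define cf where "cf t j = (- 1) ^ (r + t) *
    minor_at r x (\<lambda>t'. (y(r := j)) (if t' < t then t' else Suc t')) A" for t j
  have cfr: "cf r j \<noteq> 0" "cf r j = cf r 0" for j
  proof -
    have "mat r r (\<lambda>(s, t). A $$ (x s, (y(r := j)) (if t < r then t else Suc t))) = mat r r (\<lambda>(s, t). A $$ (x s, y t))" for j
      by (intro eq_matI) auto
    then have "cf r j = (- 1) ^ (r + r) * minor_at r x y A" for j unfolding cf_def by simp
    then show "cf r j \<noteq> 0" "cf r j = cf r 0" using xy(2) by simp_all
  qed
  have entry: "(\<Sum>t<r. A $$ (i, y t) * cf t j) + A $$ (i, j) * cf r j = 0" if ij: "i < m" "j < q" for i j
  proof -
    let ?N = "mat (Suc r) (Suc r) (\<lambda>(s, t). A $$ ((x(r := i)) s, (y(r := j)) t))"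
    have "\<forall>t<Suc r. (x(r := i)) t < m \<and> (y(r := j)) t < q" using xy(1) ij by (auto simp: less_Suc_eq)
    then have "det ?N = 0" using \<open>\<not> nz (Suc r)\<close> unfolding nz_def by blast
    moreover have "det ?N = (\<Sum>t<Suc r. ?N $$ (r, t) * cofactor ?N r t)"
      by (rule laplace_expansion_row) auto
    moreover have "cofactor ?N r t = cf t j" if "t < Suc r" for t
    proof -
      have "mat_delete ?N r t = mat r r (\<lambda>(s, t'). A $$ (x s, (y(r := j)) (if t' < t then t' else Suc t')))"
        unfolding mat_delete_def using that by (intro eq_matI) (auto simp: less_Suc_eq)
      then show ?thesis unfolding cofactor_def cf_def by simp
    qed
    ultimately show ?thesis by simp
  qed
  define z where "z = case_sum (\<lambda>(i, k). if k < r then A $$ (i, y k) else 0) (\<lambda>(j, k). - cf k j / cf r j)"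
  have "\<psi> n m q (point_of n m q z) = A"
  proof (rule eq_matI)
    fix i j assume "i < dim_row A" "j < dim_col A"
    then have ij: "i < m" "j < q" using AM by auto
    have "(\<Sum>k<n. z (Inl (i, k)) * z (Inr (j, k))) = (\<Sum>k<r. A $$ (i, y k) * (- cf k j / cf r j))"
      using r by (intro sum.mono_neutral_cong_right) (auto simp: z_def)
    also have "\<dots> = - (\<Sum>k<r. A $$ (i, y k) * cf k j) / cf r j"
      by (simp add: sum_divide_distrib sum_negf)
    also have "\<dots> = A $$ (i, j)" unfolding minus_unique[OF entry[OF ij]] using cfr(1)[of j] by simp
    finally show "\<psi> n m q (point_of n m q z) $$ (i, j) = A $$ (i, j)" using ij by (simp add: \<psi>_point_of)
  qed (use AM in \<open>auto simp: \<psi>_point_of\<close>)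
  then show thesis using that point_of_in_X by blast
qed

lemma \<psi>_outside: "p \<notin> X_points n m q \<Longrightarrow> \<psi> n m q p = undefined"
  unfolding \<psi>_def by (rule restrict_apply[THEN trans]) (simp only: if_False)

lemma \<psi>_in_determinantal_variety:
  fixes p :: "'k :: comm_ring_1 point"
  assumes p: "p \<in> X_points n m q"
  shows "\<psi> n m q p \<in> determinantal_variety (n + 1) m q"
  unfolding determinantal_variety_def
  using \<psi>_carrier[OF p] determinantal_ideal_vanishes[OF _ p] by blast

lemma invariant_ring_carrier:
  "carrier (invariant_ring n m q) = {f \<in> regular_X n m q.
     invariant_map (carrier (GL TYPE('k) n)) (GL_act n m q) (X_points n m q) (f :: 'k :: field point \<Rightarrow> 'k)}"
  by (simp add: invariant_ring_def function_ring_def)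

lemma invariant_ring_cring: "cring (invariant_ring n m q :: ('k :: field point \<Rightarrow> 'k) ring)"
  unfolding invariant_ring_def
proof (rule function_ring_cring)
  let ?F = "{f \<in> regular_X n m q. invariant_map (carrier (GL TYPE('k) n)) (GL_act n m q) (X_points n m q) f}"
  show "restrict f (X_points n m q) = f" if "f \<in> ?F" for f
    using that regular_restrict unfolding regular_X_def by blast
  show "(\<lambda>p\<in>X_points n m q. c) \<in> ?F" for c
    by (auto simp: invariant_map_def GL_act_X regular_X_def intro: regular_functions.const)
  fix f g assume fg: "f \<in> ?F" "g \<in> ?F"
  then have reg: "f \<in> regular_X n m q" "g \<in> regular_X n m q" by auto
  show "(\<lambda>p\<in>X_points n m q. f p + g p) \<in> ?F"
    using regular_functions.add[OF reg[unfolded regular_X_def]] fg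
    by (auto simp: invariant_map_def GL_act_X regular_X_def)
  show "(\<lambda>p\<in>X_points n m q. f p * g p) \<in> ?F"
    using regular_functions.mult[OF reg[unfolded regular_X_def]] fg
    by (auto simp: invariant_map_def GL_act_X regular_X_def)
qed

lemma \<psi>_pullback_invariant:
  fixes f :: "'k :: field mat \<Rightarrow> 'k"
  assumes "f \<in> regular_M m q"
  shows "pullback (X_points n m q) (\<psi> n m q) f \<in> carrier (invariant_ring n m q)"
  using \<psi>_pullback_regular[OF assms]
  by (auto simp: invariant_ring_carrier invariant_map_def pullback_def GL_act_X \<psi>_invariant)

lemma invariant_ring_simps:
  "f \<otimes>\<^bsub>invariant_ring n m q\<^esub> g = (\<lambda>p\<in>X_points n m q. f p * g p)"
  "f \<oplus>\<^bsub>invariant_ring n m q\<^esub> g = (\<lambda>p\<in>X_points n m q. f p + g p)"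
  "\<zero>\<^bsub>invariant_ring n m q\<^esub> = (\<lambda>p\<in>X_points n m q. 0)"
  "\<one>\<^bsub>invariant_ring n m q\<^esub> = (\<lambda>p\<in>X_points n m q. 1)"
  by (simp_all add: invariant_ring_def function_ring_def)

lemma \<psi>_pullback_hom_invariants:
  "ring_hom_ring (matrix_ring m q) (invariant_ring n m q) (pullback (X_points n m q) (\<psi> n m q)
     :: ('k :: field mat \<Rightarrow> 'k) \<Rightarrow> _)"
proof (rule ring_hom_ringI)
  show "Ring.ring (matrix_ring m q :: ('k mat \<Rightarrow> 'k) ring)" "Ring.ring (invariant_ring n m q :: ('k point \<Rightarrow> 'k) ring)"
    by (intro cring.axioms(1) matrix_ring_cring invariant_ring_cring)+
  fix f :: "'k mat \<Rightarrow> 'k" assume "f \<in> carrier (matrix_ring m q)"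
  then show "pullback (X_points n m q) (\<psi> n m q) f \<in> carrier (invariant_ring n m q)"
    by (simp add: matrix_ring_simps \<psi>_pullback_invariant)
qed (auto simp: matrix_ring_simps invariant_ring_simps pullback_def \<psi>_carrier intro!: restrict_ext)

lemma determinantal_ideal_kernel:
  assumes "\<zero>\<^bsub>S\<^esub> = (\<lambda>p\<in>X_points n m q. 0)"
  shows "a_kernel (matrix_ring m q) S (pullback (X_points n m q) (\<psi> n m q))
    = (determinantal_ideal (n + 1) m q :: ('k :: alg_closed_field mat \<Rightarrow> 'k) set)"
proof (intro equalityI subsetI)
  fix f :: "'k mat \<Rightarrow> 'k"
  assume "f \<in> a_kernel (matrix_ring m q) S (pullback (X_points n m q) (\<psi> n m q))"
  then have f: "f \<in> regular_M m q" and z: "pullback (X_points n m q) (\<psi> n m q) f = (\<lambda>p\<in>X_points n m q. 0)"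
    unfolding a_kernel_def' assms by (simp_all add: matrix_ring_simps)
  show "f \<in> determinantal_ideal (n + 1) m q"
  proof (rule second_fundamental_theorem[OF f])
    fix p :: "'k point" assume "p \<in> X_points n m q"
    then show "f (\<psi> n m q p) = 0" using fun_cong[OF z, of p] by (simp add: pullback_def)
  qed
next
  fix f :: "'k mat \<Rightarrow> 'k" assume f: "f \<in> determinantal_ideal (n + 1) m q"
  have "pullback (X_points n m q) (\<psi> n m q) f = (\<lambda>p\<in>X_points n m q. 0)"
    unfolding pullback_def by (intro restrict_ext determinantal_ideal_vanishes[OF f])
  then show "f \<in> a_kernel (matrix_ring m q) S (pullback (X_points n m q) (\<psi> n m q))"
    using ideal.Icarr[OF determinantal_ideal_ideal f] unfolding a_kernel_def' assms by simp
qed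

lemma restriction_regular:
  assumes "T' \<subseteq> T" "f \<in> regular_functions T C"
  shows "restrict f T' \<in> regular_functions T' C"
proof -
  have "pullback T' (\<lambda>x. x) f \<in> regular_functions T' C"
  proof (rule pullback_regular[OF _ _ assms(2)])
    fix g assume "g \<in> C"
    then have "restrict g T' \<in> regular_functions T' C" by (rule regular_functions.coord)
    moreover have "pullback T' (\<lambda>x. x) (restrict g T) = restrict g T'"
      unfolding pullback_def using assms(1) by (intro restrict_ext) auto
    ultimately show "pullback T' (\<lambda>x. x) (restrict g T) \<in> regular_functions T' C" by (simp only:)
  qed (use assms(1) in auto)
  then show ?thesis by (simp add: pullback_def)
qed

text \<open>
  The coordinates of an invariant morphism are invariant functions, hence polynomials in the entries of
  \<open>\<psi>\<close>. These polynomials, restricted to the determinantal variety, define the factorisation; its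
  image lies in \<open>Z\<close>, and it is unique, because \<open>\<psi>\<close> is onto.
\<close>

lemma \<psi>_categorical_quotient:
  assumes nm: "n < m" "n < q"
  shows "affine_categorical_quotient (carrier (GL TYPE('k :: alg_closed_field) n)) (GL_act n m q)
    (X_points n m q) (regular_X n m q) (determinantal_variety (n + 1) m q)
    (regular_functions (determinantal_variety (n + 1) m q) (matrix_coordinates m q)) (\<psi> n m q)"
proof -
  let ?X = "X_points n m q :: 'k point set" and ?D = "determinantal_variety (n + 1) m q :: 'k mat set"
  let ?RD = "regular_functions ?D (matrix_coordinates m q)"
  let ?\<Gamma> = "carrier (GL TYPE('k) n)"
  have DM: "?D \<subseteq> carrier_mat m q" by (auto simp: determinantal_variety_def)
  note \<psi>D = \<psi>_in_determinantal_variety[of _ n m q, where 'k = 'k]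
  have \<psi>maps: "\<psi> n m q \<in> regular_maps ?X (regular_X n m q) ?D ?RD"
    unfolding regular_maps_def
  proof (intro CollectI conjI ballI)
    show "\<psi> n m q \<in> ?X \<rightarrow>\<^sub>E ?D"
      by (rule PiE_I[OF \<psi>D \<psi>_outside])
    fix f assume f: "f \<in> ?RD"
    show "pullback ?X (\<psi> n m q) f \<in> regular_X n m q"
      unfolding regular_X_def
    proof (rule pullback_regular[OF _ \<psi>D f])
      fix g :: "'k mat \<Rightarrow> 'k" assume "g \<in> matrix_coordinates m q"
      then have "restrict g (carrier_mat m q) \<in> regular_M m q" by (rule regular_functions.coord)
      from \<psi>_pullback_regular[OF this, of n]
      have "pullback ?X (\<psi> n m q) (restrict g (carrier_mat m q)) \<in> regular_functions ?X (X_coordinates n m q)"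
        by (simp only: regular_X_def)
      moreover have "pullback ?X (\<psi> n m q) (restrict g ?D) = pullback ?X (\<psi> n m q) (restrict g (carrier_mat m q))"
        unfolding pullback_def by (intro restrict_ext) (simp only: restrict_apply' \<psi>D \<psi>_carrier)
      ultimately show "pullback ?X (\<psi> n m q) (restrict g ?D) \<in> regular_functions ?X (X_coordinates n m q)"
        by (simp only:)
    qed
  qed
  have universal: "\<exists>!\<phi>'. \<phi>' \<in> regular_maps ?D ?RD Z (regular_functions Z (affine_coordinates N)) \<and>
      (\<forall>p\<in>?X. \<phi> p = \<phi>' (\<psi> n m q p))"
    if Z: "affine_closed N Z" and \<phi>: "\<phi> \<in> regular_maps ?X (regular_X n m q) Z (regular_functions Z (affine_coordinates N))"
      and inv: "invariant_map ?\<Gamma> (GL_act n m q) ?X \<phi>"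
    for N and Z :: "'k vec set" and \<phi>
  proof -
    have ZN: "Z \<subseteq> carrier_vec N" using Z by (auto simp: affine_closed_def)
    have \<phi>Z: "\<phi> p \<in> Z" if "p \<in> ?X" for p using \<phi> that by (auto simp: regular_maps_def)
    have "\<exists>P\<in>regular_M m q. \<forall>p\<in>?X. \<phi> p $ k = P (\<psi> n m q p)" if k: "k < N" for k
    proof -
      let ?f = "pullback ?X \<phi> (\<lambda>z\<in>Z. z $ k)"
      have "(\<lambda>z\<in>Z. z $ k) \<in> regular_functions Z (affine_coordinates N)"
        by (rule regular_functions.coord) (use k in \<open>auto simp: affine_coordinates_def\<close>)
      then have "?f \<in> regular_X n m q" using \<phi> unfolding regular_maps_def by blast
      moreover have "invariant_map ?\<Gamma> (GL_act n m q) ?X ?f"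
        using inv by (auto simp: invariant_map_def pullback_def GL_act_X)
      ultimately obtain P where P: "P \<in> regular_M m q" "\<forall>p\<in>?X. ?f p = P (\<psi> n m q p)"
        using first_fundamental_theorem[OF nm] by blast
      then show ?thesis using \<phi>Z by (intro bexI[of _ P]) (auto simp: pullback_def)
    qed
    then obtain P where P: "\<And>k. k < N \<Longrightarrow> P k \<in> regular_M m q"
      and \<phi>P: "\<And>k p. k < N \<Longrightarrow> p \<in> ?X \<Longrightarrow> \<phi> p $ k = P k (\<psi> n m q p)" by metis
    define \<phi>' where "\<phi>' = (\<lambda>A\<in>?D. vec N (\<lambda>k. P k A))"
    have factor: "\<phi> p = \<phi>' (\<psi> n m q p)" if p: "p \<in> ?X" for p
    proof (rule eq_vecI)
      show "dim_vec (\<phi> p) = dim_vec (\<phi>' (\<psi> n m q p))"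
        using \<phi>Z[OF p] ZN \<psi>D[OF p] by (auto simp: \<phi>'_def)
    qed (use \<phi>P p \<psi>D[OF p] in \<open>auto simp: \<phi>'_def\<close>)
    have \<phi>'Z: "\<phi>' A \<in> Z" if "A \<in> ?D" for A
      using \<psi>_onto_determinantal_variety[OF that] factor \<phi>Z by metis
    have "\<phi>' \<in> regular_maps ?D ?RD Z (regular_functions Z (affine_coordinates N))"
      unfolding regular_maps_def
    proof (intro CollectI conjI ballI)
      show "\<phi>' \<in> ?D \<rightarrow>\<^sub>E Z" by (rule PiE_I[OF \<phi>'Z]) (simp_all add: \<phi>'_def)
      fix f assume f: "f \<in> regular_functions Z (affine_coordinates N)"
      show "pullback ?D \<phi>' f \<in> ?RD"
      proof (rule pullback_regular[OF _ \<phi>'Z f])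
        fix g :: "'k vec \<Rightarrow> 'k" assume "g \<in> affine_coordinates N"
        then obtain k where g: "g = (\<lambda>z. z $ k)" "k < N" by (auto simp: affine_coordinates_def)
        have "pullback ?D \<phi>' (restrict g Z) = restrict (P k) ?D"
          unfolding pullback_def using \<phi>'Z g by (intro restrict_ext) (simp, simp add: \<phi>'_def)
        then show "pullback ?D \<phi>' (restrict g Z) \<in> ?RD"
          using restriction_regular[OF DM P[OF g(2)]] by (simp only:)
      qed
    qed
    moreover have "\<phi>1 = \<phi>2"
      if "\<phi>1 \<in> ?D \<rightarrow>\<^sub>E Z" "\<phi>2 \<in> ?D \<rightarrow>\<^sub>E Z"
        "\<forall>p\<in>?X. \<phi> p = \<phi>1 (\<psi> n m q p)" "\<forall>p\<in>?X. \<phi> p = \<phi>2 (\<psi> n m q p)" for \<phi>1 \<phi>2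
    proof (rule PiE_ext[OF that(1,2)])
      fix A :: "'k mat" assume "A \<in> ?D"
      then obtain p where "p \<in> ?X" "\<psi> n m q p = A" by (rule \<psi>_onto_determinantal_variety)
      then show "\<phi>1 A = \<phi>2 A" using that(3,4) by metis
    qed
    ultimately show ?thesis using factor unfolding regular_maps_def by blast
  qed
  show ?thesis
    unfolding affine_categorical_quotient_def
    using \<psi>maps universal \<psi>_invariant by (auto simp: invariant_map_def)
qed

theorem theorem2p2p1:
  fixes n m q :: nat
    and X :: "'k :: alg_closed_field point set"
    and D :: "'k mat set"
    and KD :: "('k mat \<Rightarrow> 'k) set ring"
  assumes "m > n" and "q > n"
    and "X = X_points n m q"
    and "D = determinantal_variety (n + 1) m q"
    and "KD = determinantal_ring (n + 1) m q"
  shows "\<psi> n m q \<in> regular_maps X (regular_X n m q)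
             (carrier_mat m q) (regular_functions (carrier_mat m q) (matrix_coordinates m q)) \<and>
         \<psi> n m q ` X \<subseteq> D \<and>
         (\<forall>f\<in>carrier (matrix_ring m q).
            \<psi>_star n m q (determinantal_ideal (n + 1) m q +>\<^bsub>matrix_ring m q\<^esub> f)
              = pullback X (\<psi> n m q) f) \<and>
         \<psi>_star n m q \<in> Ring.ring_hom KD (X_ring n m q) \<and>
         \<psi>_star n m q \<in> ring_iso KD (invariant_ring n m q) \<and>
         affine_categorical_quotient (carrier (GL TYPE('k) n)) (GL_act n m q)
           X (regular_X n m q) D (regular_functions D (matrix_coordinates m q)) (\<psi> n m q)"
proof -
  let ?X = "X_points n m q :: 'k point set"
  let ?\<phi> = "pullback ?X (\<psi> n m q)"
  let ?M = "matrix_ring m q :: ('k mat \<Rightarrow> 'k) ring"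
  interpret toX: ring_hom_ring ?M "X_ring n m q" ?\<phi> by (rule \<psi>_pullback_hom)
  interpret toInv: ring_hom_ring ?M "invariant_ring n m q" ?\<phi> by (rule \<psi>_pullback_hom_invariants)
  have kX: "a_kernel ?M (X_ring n m q) ?\<phi> = determinantal_ideal (n + 1) m q"
    by (rule determinantal_ideal_kernel[OF X_ring_simps(4)])
  have kI: "a_kernel ?M (invariant_ring n m q) ?\<phi> = determinantal_ideal (n + 1) m q"
    by (rule determinantal_ideal_kernel[OF invariant_ring_simps(3)])
  have star: "\<psi>_star n m q = (\<lambda>C. the_elem (?\<phi> ` C))" by (simp add: \<psi>_star_def fun_eq_iff)
  have onto: "?\<phi> ` carrier ?M = carrier (invariant_ring n m q)"
  proof (intro equalityI subsetI)
    fix f :: "'k point \<Rightarrow> 'k" assume "f \<in> carrier (invariant_ring n m q)"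
    then have f: "f \<in> regular_X n m q" "invariant_map (carrier (GL TYPE('k) n)) (GL_act n m q) ?X f"
      by (simp_all add: invariant_ring_carrier)
    then obtain Q where Q: "Q \<in> regular_M m q" "\<forall>p\<in>?X. f p = Q (\<psi> n m q p)"
      using first_fundamental_theorem[OF assms(1,2)] by blast
    have "?\<phi> Q = restrict f ?X" unfolding pullback_def using Q(2) by (intro restrict_ext) simp
    also have "\<dots> = f" using f(1) unfolding regular_X_def by (rule regular_restrict)
    finally show "f \<in> ?\<phi> ` carrier ?M" using Q(1) by (auto simp: matrix_ring_simps)
  qed (use toInv.hom_closed in blast)
  have "\<psi> n m q \<in> regular_maps X (regular_X n m q) (carrier_mat m q) (regular_M m q)"
    unfolding regular_maps_def assms(3)
  proof (intro CollectI conjI ballI)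
    show "\<psi> n m q \<in> ?X \<rightarrow>\<^sub>E carrier_mat m q" by (rule PiE_I[OF \<psi>_carrier \<psi>_outside])
  qed (rule \<psi>_pullback_regular)
  moreover have "\<psi> n m q ` X \<subseteq> D"
    unfolding assms(3,4) using \<psi>_in_determinantal_variety by blast
  moreover have "\<forall>f\<in>carrier ?M. \<psi>_star n m q (determinantal_ideal (n + 1) m q +>\<^bsub>?M\<^esub> f) = pullback X (\<psi> n m q) f"
    using toX.the_elem_simp unfolding kX star assms(3) by blast
  moreover have "\<psi>_star n m q \<in> Ring.ring_hom KD (X_ring n m q)"
    using toX.the_elem_hom unfolding kX star assms(5) determinantal_ring_def .
  moreover have "\<psi>_star n m q \<in> ring_iso KD (invariant_ring n m q)"
    using toInv.FactRing_iso_set[OF onto] unfolding kI star assms(5) determinantal_ring_def .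
  ultimately show ?thesis using \<psi>_categorical_quotient[OF assms(1,2)] unfolding assms(3,4) by blast
qed

end
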